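(* Let $X$ be a real infinite-dimensional separable Banach space that is both uniformly rotund and uniformly smooth. Let $\mathcal B$ be any collection of closed balls of $X$, each of positive radius, such that every point of $X$ belongs to some member of $\mathcal B$. Then $\mathcal B$ is not point-finite; that is, there exists a point of $X$ that belongs to infinitely many members of $\mathcal B$.
   Context: A collection $\mathcal A$ of subsets of $X$ is point-finite if every point of $X$ belongs to at most finitely many elements of $\mathcal A$. "Uniformly rotund" means uniformly convex. Uniform rotundity and uniform smoothness refer to the given norm of $X$, which is also the norm defining the balls. *)

theory Defs
  imports "HOL-Analysis.Analysis"
begin

definition uniformly_rotund :: "'a::real_normed_vector itself \<Rightarrow> bool" where
  "uniformly_rotund _ \<longleftrightarrow>
     (\<forall>\<epsilon>>0. \<exists>\<delta>>0. \<forall>x y::'a.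
        norm x = 1 \<longrightarrow> norm y = 1 \<longrightarrow> norm (x - y) \<ge> \<epsilon> \<longrightarrow> norm ((x + y) /\<^sub>R 2) \<le> 1 - \<delta>)"

(* For t \<ge> 0 the set below is bounded above by t, and it is nonempty unless 'a is
   the zero space, so the real-valued Sup is the genuine supremum. *)
definition modulus_of_smoothness :: "'a::real_normed_vector itself \<Rightarrow> real \<Rightarrow> real" where
  "modulus_of_smoothness _ t =
     Sup {(norm (x + y) + norm (x - y)) / 2 - 1 | x y :: 'a. norm x = 1 \<and> norm y = t}"

definition uniformly_smooth :: "'a::real_normed_vector itself \<Rightarrow> bool" where
  "uniformly_smooth T \<longleftrightarrow> ((\<lambda>t. modulus_of_smoothness T t / t) \<longlongrightarrow> 0) (at_right 0)"

definition point_finite :: "'a set set \<Rightarrow> bool" where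
  "point_finite \<A> \<longleftrightarrow> (\<forall>x. finite {A \<in> \<A>. x \<in> A})"

end

theory Submission
  imports Defs
begin

text \<open>Suppose the covering is point-finite, and let \<open>Q\<close> be the closed set of points lying in the
  interior of no ball. If \<open>Q\<close> is nonempty, Baire's theorem yields \<open>z \<in> Q\<close> near which \<open>Q\<close> is contained
  in a single sphere, so that a small affine piece of finite codimension close to \<open>z\<close> misses \<open>Q\<close>; if \<open>Q\<close> is
  empty, the whole space does. On such a piece choose directions that are Birkhoff orthogonal to all
  centre-to-point vectors that matter so far: the norm of such a vector can only grow along the new
  direction, and uniform rotundity makes it grow enough to leave the balls met before. The balls needed
  to cover what the first \<open>n\<close> directions reach, but not needed earlier, form finite levels
  \<open>L 0, L 1, \<dots>\<close>, and Sperner's lemma gives, for every \<open>M\<close>, a point lying in a ball of each of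
  \<open>L 0, \<dots>, L M\<close>. Closed balls of a uniformly rotund Banach space have the finite intersection property,
  so some point lies in a ball of every level. Uniform smoothness linearizes orthogonality and bounds
  the radii of the balls near a point.\<close>

section \<open>Uniform rotundity\<close>

text \<open>If one of the vectors is shorter than \<open>1 - \<tau>\<close>, the triangle inequality
  suffices. Otherwise normalizing moves each by at most \<open>\<tau>\<close>, and the condition on
  the unit sphere applies at distance \<open>\<epsilon>/2\<close>.\<close>

lemma rotund_unit_ball:
  assumes "uniformly_rotund TYPE('a::real_normed_vector)" and "\<epsilon> > 0"
  obtains \<delta> where "\<delta> > 0"
    and "\<And>x y::'a. \<lbrakk>norm x \<le> 1; norm y \<le> 1; norm (x - y) \<ge> \<epsilon>\<rbrakk> \<Longrightarrow> norm (x + y) \<le> 2 - 2 * \<delta>"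
proof -
  obtain d where d: "d > 0"
    and D: "\<And>x y::'a. norm x = 1 \<Longrightarrow> norm y = 1 \<Longrightarrow> norm (x - y) \<ge> \<epsilon>/2 \<Longrightarrow> norm ((x + y) /\<^sub>R 2) \<le> 1 - d"
    using assms unfolding uniformly_rotund_def by (meson half_gt_zero)
  define \<tau> where "\<tau> = Min {\<epsilon>/4, d/2, 1/2}"
  have \<tau>: "\<tau> > 0" "\<tau> \<le> \<epsilon>/4" "\<tau> \<le> d/2" "\<tau> \<le> 1/2"
    using assms d by (auto simp: \<tau>_def)
  have "norm (x + y) \<le> 2 - \<tau>" if xy: "norm x \<le> 1" "norm y \<le> 1" "norm (x - y) \<ge> \<epsilon>" for x y :: 'a
  proof (cases "norm x < 1 - \<tau> \<or> norm y < 1 - \<tau>")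
    case True
    then show ?thesis
      using norm_triangle_ineq[of x y] xy by linarith
  next
    case False
    then have nz: "norm x > 0" "norm y > 0"
      using \<tau> by linarith+
    have near: "norm (u - sgn u) \<le> \<tau>" if "norm u \<le> 1" "\<not> norm u < 1 - \<tau>" "norm u > 0" for u :: 'a
    proof -
      have "u - sgn u = (norm u - 1) *\<^sub>R sgn u"
        using that by (simp add: sgn_div_norm algebra_simps)
      then have "norm (u - sgn u) = \<bar>norm u - 1\<bar>"
        using that by (simp add: norm_sgn)
      then show ?thesis
        using that by linarith
    qed
    have nx: "norm (x - sgn x) \<le> \<tau>" and ny: "norm (y - sgn y) \<le> \<tau>"
      using near False xy nz by auto
    have "norm (x - y) \<le> norm (sgn x - sgn y) + norm (x - sgn x) + norm (y - sgn y)"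
      using norm_triangle_ineq[of "sgn x - sgn y" "(x - sgn x) - (y - sgn y)"]
        norm_triangle_ineq4[of "x - sgn x" "y - sgn y"] by (simp add: algebra_simps)
    then have "norm (sgn x - sgn y) \<ge> \<epsilon>/2"
      using nx ny xy \<tau> by linarith
    then have "norm ((sgn x + sgn y) /\<^sub>R 2) \<le> 1 - d"
      using D[of "sgn x" "sgn y"] nz by (auto simp: norm_sgn)
    then have "norm (sgn x + sgn y) \<le> 2 - 2 * d"
      by simp
    moreover have "norm ((sgn x + sgn y) + ((x - sgn x) + (y - sgn y)))
        \<le> norm (sgn x + sgn y) + (norm (x - sgn x) + norm (y - sgn y))"
      by (intro norm_triangle_mono order_refl)
    then have "norm (x + y) \<le> norm (sgn x + sgn y) + (norm (x - sgn x) + norm (y - sgn y))"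
      by simp
    ultimately show ?thesis
      using nx ny \<tau> by linarith
  qed
  then show thesis
    using that[of "\<tau>/2"] \<tau> by auto
qed

lemma rotund_ball:
  assumes "uniformly_rotund TYPE('a::real_normed_vector)" and "\<epsilon> > 0"
  obtains \<delta> where "\<delta> > 0"
    and "\<And>(x::'a) y s. \<lbrakk>norm x \<le> s; norm y \<le> s; 0 < s; norm (x - y) \<ge> \<epsilon> * s\<rbrakk> \<Longrightarrow> norm (x + y) \<le> 2 * s * (1 - \<delta>)"
proof -
  obtain \<delta> where "\<delta> > 0"
    and D: "\<And>x y::'a. \<lbrakk>norm x \<le> 1; norm y \<le> 1; norm (x - y) \<ge> \<epsilon>\<rbrakk> \<Longrightarrow> norm (x + y) \<le> 2 - 2 * \<delta>"
    using rotund_unit_ball[OF assms] by blast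
  moreover have "norm (x + y) \<le> 2 * s * (1 - \<delta>)"
    if h: "norm x \<le> s" "norm y \<le> s" "0 < s" "norm (x - y) \<ge> \<epsilon> * s" for x y :: 'a and s
  proof -
    have e: "norm (x /\<^sub>R s - y /\<^sub>R s) = norm (x - y) / s" "norm (x /\<^sub>R s + y /\<^sub>R s) = norm (x + y) / s"
      using h by (simp_all flip: scaleR_diff_right scaleR_add_right add: divide_inverse mult.commute)
    have "norm (x + y) / s \<le> 2 - 2 * \<delta>"
      using D[of "x /\<^sub>R s" "y /\<^sub>R s"] h unfolding e by (auto simp: field_simps)
    then show ?thesis
      using h by (simp add: field_simps)
  qed
  ultimately show thesis
    using that by blast
qed

text \<open>Not symmetric in general. Typically \<open>v\<close> leads from the centre of a ball to
  a point and \<open>y\<close> is the direction in which the point moves.\<close>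

definition birkhoff_orth :: "'a::real_normed_vector \<Rightarrow> 'a \<Rightarrow> bool" (infix "\<bottom>\<^sub>B" 50)
  where "v \<bottom>\<^sub>B y \<longleftrightarrow> (\<forall>t. norm v \<le> norm (v + t *\<^sub>R y))"

lemma birkhoff_orthD: "v \<bottom>\<^sub>B y \<Longrightarrow> norm v \<le> norm (v + y)"
  unfolding birkhoff_orth_def by (metis scaleR_one)

text \<open>Were \<open>v + y\<close> no longer than \<open>r + \<eta>\<close>, neither would
  \<open>v\<close> be, and rotundity would make their midpoint much shorter; but by orthogonality
  the midpoint is no shorter than \<open>v\<close>. One \<open>\<eta>\<close> serves all radii up to
  \<open>R\<close>.\<close>

lemma rotund_exit:
  assumes ur: "uniformly_rotund TYPE('a::real_normed_vector)" and \<theta>: "\<theta> > 0"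
  obtains \<eta> where "\<eta> > 0"
    and "\<And>(v::'a) y r. \<lbrakk>v \<bottom>\<^sub>B y; norm y \<ge> \<theta>; r \<le> R; norm v \<ge> r - \<eta>\<rbrakk> \<Longrightarrow> norm (v + y) > r + \<eta>"
proof -
  define R' where "R' = max R 0 + 1"
  have R': "R' > 0" "R + 1 \<le> R'"
    by (auto simp: R'_def)
  obtain \<delta> where d: "\<delta> > 0"
    and D: "\<And>(x::'a) y s. \<lbrakk>norm x \<le> s; norm y \<le> s; 0 < s; norm (x - y) \<ge> (\<theta>/R') * s\<rbrakk> \<Longrightarrow> norm (x + y) \<le> 2 * s * (1 - \<delta>)"
    using rotund_ball[OF ur, of "\<theta>/R'"] \<theta> R' by auto
  \<comment> \<open>The bound \<open>1\<close> keeps \<open>r + \<eta>\<close> at most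
    \<open>R'\<close>; the other one contradicts
    \<open>\<theta> * \<delta> / 2 \<le> 2 * \<eta>\<close>, which is derived at the end.\<close>
  define \<eta> where "\<eta> = min 1 (\<theta> * \<delta> / 8)"
  have e: "\<eta> > 0" "\<eta> \<le> 1" "\<eta> \<le> \<theta> * \<delta> / 8"
    using \<theta> d by (auto simp: \<eta>_def)
  have "norm (v + y) > r + \<eta>"
    if h: "v \<bottom>\<^sub>B y" "norm y \<ge> \<theta>" "r \<le> R" "norm v \<ge> r - \<eta>" for v y :: 'a and r
  proof (rule ccontr)
    assume "\<not> norm (v + y) > r + \<eta>"
    then have vy: "norm (v + y) \<le> r + \<eta>"
      by simp
    with birkhoff_orthD[OF h(1)] have v: "norm v \<le> r + \<eta>"
      by simp
    \<comment> \<open>A long \<open>y\<close> joins two vectors of norm at most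
      \<open>r + \<eta>\<close>, so this radius cannot be small; small or negative \<open>r\<close>
      is covered in this way.\<close>
    have "norm y \<le> norm (v + y) + norm v"
      using norm_triangle_ineq4[of "v + y" v] by simp
    with vy v h have s: "r + \<eta> \<ge> \<theta> / 2"
      by linarith
    have s0: "r + \<eta> > 0" and sR: "r + \<eta> \<le> R'"
      using s \<theta> h e R' by linarith+
    have "(\<theta> / R') * (r + \<eta>) \<le> (\<theta> / R') * R'"
      using sR \<theta> R' by (intro mult_left_mono) auto
    also have "\<dots> \<le> norm (v - (v + y))"
      using h R' by simp
    finally have "norm (v + (v + y)) \<le> 2 * (r + \<eta>) * (1 - \<delta>)"
      using D[OF v vy s0] by simp
    moreover have "norm (v + (v + y)) = 2 * norm (v + (1/2) *\<^sub>R y)"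
    proof -
      have "v + (v + y) = 2 *\<^sub>R (v + (1/2) *\<^sub>R y)"
        by (simp add: scaleR_2 algebra_simps)
      then show ?thesis
        by simp
    qed
    moreover have "norm v \<le> norm (v + (1/2) *\<^sub>R y)"
      using h(1) by (auto simp: birkhoff_orth_def)
    ultimately have "r - \<eta> \<le> (r + \<eta>) * (1 - \<delta>)"
      using h(4) by linarith
    then have "(r + \<eta>) * \<delta> \<le> 2 * \<eta>"
      by (simp add: algebra_simps)
    moreover have "(\<theta> / 2) * \<delta> \<le> (r + \<eta>) * \<delta>"
      using s d by (intro mult_right_mono) auto
    moreover have "\<theta> * \<delta> > 0"
      using \<theta> d by simp
    ultimately show False
      using e by linarith
  qed
  with e show thesis
    using that by blast
qed

text \<open>Elements of almost minimal norm in the members of the chain form a Cauchy sequence.\<close>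

lemma rotund_decreasing_Inter:
  fixes C :: "nat \<Rightarrow> 'a::banach set"
  assumes ur: "uniformly_rotund TYPE('a)"
    and cl: "\<And>n. closed (C n)" and cv: "\<And>n. convex (C n)" and ne: "\<And>n. C n \<noteq> {}"
    and dec: "\<And>n. C (Suc n) \<subseteq> C n" and bd: "bounded (C 0)"
  shows "(\<Inter>n. C n) \<noteq> {}"
proof -
  have anti: "C n \<subseteq> C m" if "m \<le> n" for m n
    using that dec by (rule lift_Suc_antimono_le[rotated])
  define d where "d n = (INF x\<in>C n. norm x)" for n
  have bb: "bdd_below (norm ` A)" for A :: "'a set"
    by (rule bdd_belowI[of _ 0]) auto
  have low: "d n \<le> norm x" if "x \<in> C n" for x n
    unfolding d_def using that bb by (intro cINF_lower)
  have mono: "d m \<le> d n" if "m \<le> n" for m n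
    unfolding d_def[of n] using ne anti[OF that] low by (intro cINF_greatest) auto
  obtain b where b: "\<And>x. x \<in> C 0 \<Longrightarrow> norm x \<le> b"
    using bd by (auto simp: bounded_iff)
  have up: "d n \<le> b" for n
    using ne[of n] anti[of 0 n] low[of _ n] b by (meson all_not_in_conv le0 order_trans subsetD)
  obtain L where L: "d \<longlonglongrightarrow> L" and dL: "\<And>n. d n \<le> L"
    using incseq_convergent[of d b] mono up by (auto simp: incseq_def)
  have "\<exists>x\<in>C n. norm x < d n + 1 / Suc n" for n
    using cINF_less_iff[OF ne bb, of n "d n + 1 / Suc n"] by (auto simp: d_def)
  then obtain x where xC: "\<And>n. x n \<in> C n" and xn: "\<And>n. norm (x n) < d n + 1 / Suc n"
    by metis
  have d0: "0 \<le> d n" for n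
    unfolding d_def using ne by (intro cINF_greatest) auto
  have "L \<ge> 0"
    using d0 dL order_trans by blast
  have lim0: "(\<lambda>n. 1 / real (Suc n)) \<longlonglongrightarrow> 0"
    using LIMSEQ_inverse_real_of_nat by (simp add: divide_inverse)
  have nx: "norm (x n) \<le> L + 1 / Suc m" if "m \<le> n" for m n
  proof -
    have "1 / real (Suc n) \<le> 1 / real (Suc m)"
      using that by (simp add: field_simps)
    then show ?thesis
      using xn[of n] dL[of n] by linarith
  qed
  have "Cauchy x"
  proof (rule metric_CauchyI)
    fix e :: real assume e: "e > 0"
    show "\<exists>M. \<forall>m\<ge>M. \<forall>n\<ge>M. dist (x m) (x n) < e"
    proof -
      define E where "E = e / (2 * (L + 1))"
      have E: "E > 0"
        using e \<open>L \<ge> 0\<close> by (simp add: E_def)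
      obtain \<delta> where dl: "\<delta> > 0"
        and D: "\<And>(x::'a) y s. \<lbrakk>norm x \<le> s; norm y \<le> s; 0 < s; norm (x - y) \<ge> E * s\<rbrakk> \<Longrightarrow> norm (x + y) \<le> 2 * s * (1 - \<delta>)"
        using rotund_ball[OF ur E] by blast
      show ?thesis
      \<comment> \<open>For \<open>L = 0\<close> the almost minimal elements tend to the origin. For
        \<open>L > 0\<close> rotundity would put a midpoint into \<open>C M\<close> whose norm is
        below the infimum \<open>d M\<close>.\<close>
      proof (cases "L = 0")
        case True
        obtain M where M: "1 / real (Suc M) < e/2"
          using LIMSEQ_D[OF lim0, of "e/2"] e by auto
        have "dist (x m) (x n) < e" if "m \<ge> M" "n \<ge> M" for m n
          using nx[OF that(1)] nx[OF that(2)] M True norm_triangle_ineq4[of "x m" "x n"] by (simp add: dist_norm)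
        then show ?thesis by blast
      next
        case False
        then have Lp: "L > 0"
          using \<open>L \<ge> 0\<close> by simp
        have "(\<lambda>n. (L + 1 / real (Suc n)) * (1 - \<delta>) - d n) \<longlonglongrightarrow> (L + 0) * (1 - \<delta>) - L"
          by (intro tendsto_intros lim0 L)
        moreover have "(L + 0) * (1 - \<delta>) - L < 0"
          using Lp dl by (simp add: algebra_simps)
        ultimately have "\<forall>\<^sub>F n in sequentially. (L + 1 / real (Suc n)) * (1 - \<delta>) - d n < 0"
          by (rule order_tendstoD(2))
        then obtain M where M: "(L + 1 / real (Suc M)) * (1 - \<delta>) < d M"
          unfolding eventually_sequentially by force
        have "dist (x m) (x n) < e" if mn: "m \<ge> M" "n \<ge> M" for m n
        proof (rule ccontr)
          assume "\<not> dist (x m) (x n) < e"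
          then have far: "norm (x m - x n) \<ge> e"
            by (simp add: dist_norm)
          define s where "s = L + 1 / real (Suc M)"
          have s: "0 < s" "s \<le> 2 * (L + 1)"
            using Lp by (auto simp: s_def intro!: add_pos_nonneg) (smt (verit) divide_le_eq_1 of_nat_0_le_iff)
          have "E * s \<le> E * (2 * (L + 1))"
            using E s by (intro mult_left_mono) auto
          also have "\<dots> = e"
            using \<open>L \<ge> 0\<close> by (simp add: E_def)
          finally have "norm (x m + x n) \<le> 2 * s * (1 - \<delta>)"
            using D[of "x m" s "x n"] nx[OF mn(1)] nx[OF mn(2)] far s by (simp add: s_def)
          then have "norm (x m + x n) \<le> 2 * (s * (1 - \<delta>))"
            by (simp only: mult.assoc)
          moreover have "(1/2) *\<^sub>R x m + (1/2) *\<^sub>R x n \<in> C M"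
            using cv[of M] xC[of m] xC[of n] anti[OF mn(1)] anti[OF mn(2)] by (intro convexD) auto
          then have "d M \<le> norm ((1/2) *\<^sub>R (x m + x n))"
            by (metis low scaleR_right_distrib)
          then have "2 * d M \<le> norm (x m + x n)"
            by simp
          ultimately show False
            using M unfolding s_def by linarith
        qed
        then show ?thesis by blast
      qed
    qed
  qed
  then obtain l where l: "x \<longlonglongrightarrow> l"
    using convergent_eq_Cauchy by (metis convergent_def Cauchy_convergent)
  have "l \<in> C n" for n
  proof (rule Lim_in_closed_set[OF cl _ _ l])
    show "\<forall>\<^sub>F m in sequentially. x m \<in> C n"
      using xC anti by (intro eventually_sequentiallyI[of n]) blast
  qed simp
  then show ?thesis by blast
qed

section \<open>Uniform smoothness and support functionals\<close>

text \<open>Dividing by \<open>norm v\<close> turns the modulus, taken over unit vectors, into a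
  homogeneous estimate with an error small relative to \<open>norm w\<close>. The bound is halved at
  the end because the limit controls only \<open>t < \<tau>\<close>.\<close>

lemma smooth_norm_sum:
  assumes us: "uniformly_smooth TYPE('a::real_normed_vector)" and \<epsilon>: "\<epsilon> > 0"
  obtains \<tau> where "\<tau> > 0"
    and "\<And>v w::'a. norm w \<le> \<tau> * norm v \<Longrightarrow> norm (v + w) + norm (v - w) \<le> 2 * norm v + \<epsilon> * norm w"
proof -
  let ?\<rho> = "modulus_of_smoothness TYPE('a)"
  have "\<forall>\<^sub>F t in at_right 0. ?\<rho> t / t < \<epsilon> / 2"
    using us \<epsilon> unfolding uniformly_smooth_def by (intro order_tendstoD) auto
  then obtain \<tau> where \<tau>: "\<tau> > 0" and T: "\<And>t. 0 < t \<Longrightarrow> t < \<tau> \<Longrightarrow> ?\<rho> t / t < \<epsilon> / 2"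
    unfolding eventually_at_right_field by auto
  have "norm (v + w) + norm (v - w) \<le> 2 * norm v + \<epsilon> * norm w" if vw: "norm w \<le> \<tau> / 2 * norm v" for v w :: 'a
  proof (cases "v = 0 \<or> w = 0")
    case True
    with vw \<epsilon> show ?thesis by auto
  next
    case False
    define s where "s = norm v"
    define t where "t = norm w / s"
    have "\<tau> / 2 * norm v < \<tau> * norm v"
      using False \<tau> by simp
    with vw have "norm w < \<tau> * norm v"
      by linarith
    then have s: "s > 0" and t: "t > 0" "t < \<tau>"
      using False by (auto simp: s_def t_def field_simps)
    let ?S = "{(norm (x + y) + norm (x - y)) / 2 - 1 | x y :: 'a. norm x = 1 \<and> norm y = t}"
    have "bdd_above ?S"
    proof (rule bdd_aboveI[of _ t], clarify)
      fix x y :: 'a assume xy: "norm x = 1" "t = norm y"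
      show "(norm (x + y) + norm (x - y)) / 2 - 1 \<le> norm y"
        using norm_triangle_ineq[of x y] norm_triangle_ineq4[of x y] xy(1) by argo
    qed
    moreover have "(norm (v /\<^sub>R s + w /\<^sub>R s) + norm (v /\<^sub>R s - w /\<^sub>R s)) / 2 - 1 \<in> ?S"
    proof (intro CollectI exI conjI)
      show "norm (v /\<^sub>R s) = 1" "norm (w /\<^sub>R s) = t"
        using s by (simp_all add: s_def t_def divide_inverse mult.commute)
    qed (rule refl)
    ultimately have "(norm (v /\<^sub>R s + w /\<^sub>R s) + norm (v /\<^sub>R s - w /\<^sub>R s)) / 2 - 1 \<le> ?\<rho> t"
      unfolding modulus_of_smoothness_def by (rule cSup_upper[rotated])
    moreover have "?\<rho> t < \<epsilon> / 2 * t"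
      using T[OF t] t by (simp add: field_simps)
    moreover have "norm (v /\<^sub>R s + w /\<^sub>R s) = norm (v + w) / s" "norm (v /\<^sub>R s - w /\<^sub>R s) = norm (v - w) / s"
      using s by (simp_all flip: scaleR_diff_right scaleR_add_right add: divide_inverse mult.commute)
    ultimately have "(norm (v + w) / s + norm (v - w) / s) / 2 - 1 < \<epsilon> / 2 * (norm w / s)"
      by (simp add: t_def)
    then have "(norm (v + w) + norm (v - w)) / s < 2 + \<epsilon> * (norm w / s)"
      unfolding add_divide_distrib by argo
    then have "norm (v + w) + norm (v - w) < (2 + \<epsilon> * (norm w / s)) * s"
      using s by (simp only: pos_divide_less_eq)
    also have "\<dots> = 2 * s + \<epsilon> * norm w"
      using s by (simp add: distrib_right)
    finally have "norm (v + w) + norm (v - w) < 2 * s + \<epsilon> * norm w" .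
    then show ?thesis
      by (simp add: s_def)
  qed
  with \<tau> show thesis
    using that[of "\<tau>/2"] by auto
qed

text \<open>The functional is the one-sided directional derivative of the norm at \<open>v\<close>. It is sublinear
  for every norm, and smoothness makes it odd, hence linear.\<close>

lemma smooth_support_functional:
  fixes v :: "'a::real_normed_vector"
  assumes us: "uniformly_smooth TYPE('a)"
  obtains f :: "'a \<Rightarrow> real" where "linear f" and "\<And>y. f y = 0 \<Longrightarrow> v \<bottom>\<^sub>B y"
proof (cases "v = 0")
  case True
  show ?thesis
  proof (rule that)
    show "linear (\<lambda>_. 0 :: real)"
      by (rule linearI) auto
    show "v \<bottom>\<^sub>B y" for y
      using True by (simp add: birkhoff_orth_def)
  qed
next
  case v: False
  \<comment> \<open>By convexity of the norm these quotients are nondecreasing in \<open>t\<close>,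
    so their infimum \<open>p\<close> is the derivative from the right at 0.\<close>
  define q where "q t y = (norm (v + t *\<^sub>R y) - norm v) / t" for t y
  define p where "p y = (INF t\<in>{0<..}. q t y)" for y
  have q_ge: "- norm y \<le> q t y" if "t > 0" for t y
  proof -
    have "norm v \<le> norm (v + t *\<^sub>R y) + t * norm y"
      using norm_triangle_ineq4[of "v + t *\<^sub>R y" "t *\<^sub>R y"] that by simp
    then show ?thesis
      using that by (simp add: q_def field_simps)
  qed
  have bb: "bdd_below ((\<lambda>t. q t y) ` {0<..})" for y
    using q_ge by (intro bdd_belowI2[where m = "- norm y"]) auto
  have p_le: "p y \<le> q t y" if "t > 0" for t y
    unfolding p_def using that bb by (intro cINF_lower) auto
  have p_ge: "c \<le> p y" if "\<And>t. t > 0 \<Longrightarrow> c \<le> q t y" for c y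
    unfolding p_def using that by (intro cINF_greatest) auto
  have q_mono: "q s y \<le> q t y" if st: "0 < s" "s \<le> t" for s t y
  proof -
    have "v + s *\<^sub>R y = (1 - s/t) *\<^sub>R v + (s/t) *\<^sub>R (v + t *\<^sub>R y)"
      using st by (simp add: algebra_simps)
    then have "norm (v + s *\<^sub>R y) \<le> (1 - s/t) * norm v + (s/t) * norm (v + t *\<^sub>R y)"
      using norm_triangle_ineq[of "(1 - s/t) *\<^sub>R v" "(s/t) *\<^sub>R (v + t *\<^sub>R y)"] st by simp
    then show ?thesis
      using st by (simp add: q_def field_simps)
  qed
  have q_add: "q t (x + y) \<le> q (2*t) x + q (2*t) y" if "t > 0" for t x y
  proof -
    have "v + t *\<^sub>R (x + y) = (1/2) *\<^sub>R (v + (2*t) *\<^sub>R x) + (1/2) *\<^sub>R (v + (2*t) *\<^sub>R y)"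
      by (simp add: algebra_simps flip: scaleR_add_left)
    then have "norm (v + t *\<^sub>R (x + y)) \<le> (1/2) * norm (v + (2*t) *\<^sub>R x) + (1/2) * norm (v + (2*t) *\<^sub>R y)"
      using norm_triangle_ineq[of "(1/2) *\<^sub>R (v + (2*t) *\<^sub>R x)" "(1/2) *\<^sub>R (v + (2*t) *\<^sub>R y)"] by simp
    then have "norm (v + t *\<^sub>R (x + y)) - norm v
        \<le> (norm (v + (2*t) *\<^sub>R x) - norm v) / 2 + (norm (v + (2*t) *\<^sub>R y) - norm v) / 2"
      by argo
    then have "(norm (v + t *\<^sub>R (x + y)) - norm v) / t
        \<le> ((norm (v + (2*t) *\<^sub>R x) - norm v) / 2 + (norm (v + (2*t) *\<^sub>R y) - norm v) / 2) / t"
      using that by (intro divide_right_mono) auto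
    also have "\<dots> = q (2*t) x + q (2*t) y"
      using that by (simp add: q_def add_divide_distrib)
    finally show ?thesis
      by (simp add: q_def)
  qed
  have p_add: "p (x + y) \<le> p x + p y" for x y
  proof (rule ccontr)
    assume neg: "\<not> p (x + y) \<le> p x + p y"
    define e where "e = (p (x + y) - p x - p y) / 2"
    have e: "e > 0"
      using neg by (simp add: e_def)
    have "\<exists>t>0. q t z < p z + e" for z
      using cINF_less_iff[OF _ bb, of z "p z + e"] e by (auto simp: p_def)
    then obtain s t where st: "s > 0" "q s x < p x + e" "t > 0" "q t y < p y + e"
      by meson
    define u where "u = min s t / 2"
    have u: "u > 0" "2 * u \<le> s" "2 * u \<le> t"
      using st by (auto simp: u_def)
    have "p (x + y) \<le> q u (x + y)"
      using p_le u by blast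
    also have "\<dots> \<le> q (2*u) x + q (2*u) y"
      using q_add u by blast
    also have "\<dots> \<le> q s x + q t y"
      using q_mono u by (intro add_mono) auto
    finally show False
      using st by (simp add: e_def field_simps)
  qed
  have p_scale: "p (c *\<^sub>R y) = c * p y" if "c > 0" for c y
  proof -
    have qc: "q t (c *\<^sub>R y) = c * q (t * c) y" if "t > 0" for t
      using that \<open>c > 0\<close> by (simp add: q_def)
    show ?thesis
    proof (rule antisym)
      have "p (c *\<^sub>R y) / c \<le> p y"
      proof (rule p_ge)
        fix t :: real assume "t > 0"
        then show "p (c *\<^sub>R y) / c \<le> q t y"
          using p_le[of "t/c" "c *\<^sub>R y"] qc[of "t/c"] that by (simp add: field_simps)
      qed
      then show "p (c *\<^sub>R y) \<le> c * p y"
        using that by (simp add: field_simps)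
      show "c * p y \<le> p (c *\<^sub>R y)"
        using that qc p_le by (intro p_ge) auto
    qed
  qed
  have p0: "p 0 = 0"
    using p_le[of 1 0] p_ge[of 0 0] by (auto simp: q_def intro: antisym)
  \<comment> \<open>Subadditivity gives one inequality. For the other, smoothness makes
    \<open>q t y + q t (- y)\<close> arbitrarily small at a small step \<open>t\<close>.\<close>
  have p_minus: "p (- y) = - p y" for y
  proof (rule antisym)
    show "- p y \<le> p (- y)"
      using p_add[of y "- y"] p0 by simp
    show "p (- y) \<le> - p y"
    proof (rule field_le_epsilon)
      fix e :: real assume e: "e > 0"
      define \<epsilon> where "\<epsilon> = e / (norm y + 1)"
      have \<epsilon>: "\<epsilon> > 0"
        using e by (simp add: \<epsilon>_def add_nonneg_pos)
      obtain \<tau> where "\<tau> > 0"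
        and T: "\<And>v w::'a. norm w \<le> \<tau> * norm v \<Longrightarrow> norm (v + w) + norm (v - w) \<le> 2 * norm v + \<epsilon> * norm w"
        using smooth_norm_sum[OF us \<epsilon>] by blast
      define t where "t = \<tau> * norm v / (norm y + 1)"
      have t: "t > 0"
        using v \<open>\<tau> > 0\<close> by (simp add: t_def add_nonneg_pos)
      have y1: "norm y + 1 \<noteq> 0"
        using norm_ge_zero[of y] by linarith
      have "norm (t *\<^sub>R y) \<le> t * (norm y + 1)"
        using t by simp
      also have "\<dots> = \<tau> * norm v"
        by (simp only: t_def times_divide_eq_left nonzero_mult_div_cancel_right[OF y1])
      finally have "norm (t *\<^sub>R y) \<le> \<tau> * norm v" .
      then have "norm (v + t *\<^sub>R y) + norm (v - t *\<^sub>R y) \<le> 2 * norm v + \<epsilon> * (t * norm y)"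
        using T t by fastforce
      then have "(norm (v + t *\<^sub>R y) - norm v) + (norm (v + t *\<^sub>R (- y)) - norm v) \<le> t * (\<epsilon> * norm y)"
        by (simp add: mult.left_commute)
      then have "q t y + q t (- y) \<le> \<epsilon> * norm y"
        using t by (simp only: q_def add_divide_distrib[symmetric] pos_divide_le_eq mult.commute)
      moreover have "\<epsilon> * norm y \<le> \<epsilon> * (norm y + 1)"
        using \<epsilon> by simp
      moreover have "\<epsilon> * (norm y + 1) = e"
        by (simp only: \<epsilon>_def times_divide_eq_left nonzero_mult_div_cancel_right[OF y1])
      ultimately show "p (- y) \<le> - p y + e"
        using p_le[OF t, of y] p_le[OF t, of "- y"] by linarith
    qed
  qed
  have "linear p"
  proof (rule linearI)
    fix x y
    show "p (x + y) = p x + p y"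
      using p_add[of x y] p_add[of "x + y" "- y"] p_minus[of y] by simp
  next
    fix c :: real and x
    consider "c > 0" | "c = 0" | "c < 0"
      by linarith
    then show "p (c *\<^sub>R x) = c *\<^sub>R p x"
    proof cases
      case 3
      then show ?thesis
        using p_scale[of "- c" x] p_minus[of "c *\<^sub>R x"] by simp
    qed (auto simp: p_scale p0)
  qed
  moreover have "v \<bottom>\<^sub>B y" if "p y = 0" for y
    unfolding birkhoff_orth_def
  proof
    fix t
    have "p (t *\<^sub>R y) = 0"
      using \<open>linear p\<close> that by (simp add: linear_cmul)
    then show "norm v \<le> norm (v + t *\<^sub>R y)"
      using p_le[of 1 "t *\<^sub>R y"] by (simp add: q_def)
  qed
  ultimately show ?thesis
    using that by blast
qed

section \<open>Sperner's lemma on the cube\<close>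

text \<open>\<open>b\<close> is the lower corner of a grid cell among whose vertices all labels
  occur. The assumptions \<open>zero\<close> and \<open>top\<close> are the boundary rules; they are
  translated into those of Kuhn's 0/1 labellings.\<close>

lemma cube_sperner:
  fixes lam :: "(nat \<Rightarrow> nat) \<Rightarrow> nat"
  assumes "p > 0"
    and le: "\<And>x. (\<And>j. j < n \<Longrightarrow> x j \<le> p) \<Longrightarrow> lam x \<le> n"
    and zero: "\<And>x j. (\<And>j. j < n \<Longrightarrow> x j \<le> p) \<Longrightarrow> j < n \<Longrightarrow> x j = 0 \<Longrightarrow> lam x \<noteq> Suc j"
    and top: "\<And>x j. (\<And>j. j < n \<Longrightarrow> x j \<le> p) \<Longrightarrow> j < n \<Longrightarrow> x j = p \<Longrightarrow> Suc j \<le> lam x"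
  obtains b where "\<And>m. m \<le> n \<Longrightarrow> \<exists>x. (\<forall>j<n. x j \<le> p \<and> b j \<le> x j \<and> x j \<le> Suc (b j)) \<and> lam x = m"
proof -
  \<comment> \<open>The library's Kuhn labelling counts coordinates in the opposite order.\<close>
  define flip where "flip x j = x (n - Suc j)" for x :: "nat \<Rightarrow> nat" and j
  define mu where "mu x = n - lam (flip x)" for x
  \<comment> \<open>The first nonzero index below \<open>n\<close>, or \<open>n\<close> if there is
    none, is \<open>mu x\<close>. Later entries do not affect \<open>reduced\<close> and are chosen
    to meet the boundary conditions.\<close>
  define label where "label x i = (if i < mu x then 0 else if i = mu x then 1 else if x i = 0 then 0 else 1::nat)" for x i
  have flip_le: "flip x j \<le> p" if "\<forall>j. x j \<le> p" for x j
    using that by (simp add: flip_def)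
  have red: "reduced n (label x) = mu x" for x
    by (rule reduced_labelling_unique) (auto simp: label_def mu_def)
  have z: "\<forall>x j. (\<forall>j. x j \<le> p) \<and> j < n \<and> x j = 0 \<longrightarrow> label x j = 0"
  proof (intro allI impI)
    fix x :: "nat \<Rightarrow> nat" and j
    assume h: "(\<forall>j. x j \<le> p) \<and> j < n \<and> x j = 0"
    then have "flip x (n - Suc j) = 0" "n - Suc j < n"
      by (auto simp: flip_def)
    then have "lam (flip x) \<noteq> Suc (n - Suc j)" "lam (flip x) \<le> n"
      using zero[of "flip x" "n - Suc j"] le[of "flip x"] flip_le h by auto
    then have "j \<noteq> mu x"
      using h by (auto simp: mu_def)
    then show "label x j = 0"
      using h by (auto simp: label_def)
  qed
  have t: "\<forall>x j. (\<forall>j. x j \<le> p) \<and> j < n \<and> x j = p \<longrightarrow> label x j = 1"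
  proof (intro allI impI)
    fix x :: "nat \<Rightarrow> nat" and j
    assume h: "(\<forall>j. x j \<le> p) \<and> j < n \<and> x j = p"
    then have "flip x (n - Suc j) = p" "n - Suc j < n"
      by (auto simp: flip_def)
    then have "Suc (n - Suc j) \<le> lam (flip x)"
      using top[of "flip x" "n - Suc j"] flip_le h by auto
    then have "\<not> j < mu x"
      using h by (auto simp: mu_def)
    then show "label x j = 1"
      using h \<open>p > 0\<close> by (auto simp: label_def)
  qed
  have "{s. ksimplex p n s \<and> (reduced n \<circ> label) ` s = {..n}} \<noteq> {}"
    using kuhn_combinatorial[OF \<open>p > 0\<close> z t] by (intro odd_card_imp_not_empty)
  then obtain s b u where "kuhn_simplex p n b u s" and rl: "(reduced n \<circ> label) ` s = {..n}"
    by (auto elim: ksimplex.cases)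
  interpret kuhn_simplex p n b u s by fact
  show thesis
  proof (rule that[of "flip b"])
    fix m assume m: "m \<le> n"
    then have "n - m \<in> (reduced n \<circ> label) ` s"
      using rl by simp
    then obtain x where x: "x \<in> s" "n - m = mu x"
      using red by auto
    have "flip x j \<le> p" for j
      using s_le_p[OF x(1)] by (simp add: flip_def)
    then have "lam (flip x) \<le> n"
      using le by blast
    then have "lam (flip x) = m"
      using x m by (simp add: mu_def)
    moreover have "flip x j \<le> p \<and> flip b j \<le> flip x j \<and> flip x j \<le> Suc (flip b j)" for j
      using s_le_p[OF x(1)] base_le[OF x(1)] le_Suc_base[OF x(1)] by (simp add: flip_def)
    ultimately show "\<exists>x. (\<forall>j<n. x j \<le> p \<and> flip b j \<le> x j \<and> x j \<le> Suc (flip b j)) \<and> lam x = m"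
      by blast
  qed
qed

section \<open>Subspaces of finite codimension\<close>

text \<open>Encoded by the functionals themselves, so that intersecting subspaces means uniting
  finite sets of functionals.\<close>

definition fin_codim :: "'a::real_vector set \<Rightarrow> bool"
  where "fin_codim Y \<longleftrightarrow> (\<exists>\<Phi>. finite \<Phi> \<and> (\<forall>f\<in>\<Phi>. linear (f :: 'a \<Rightarrow> real)) \<and> Y = {y. \<forall>f\<in>\<Phi>. f y = 0})"

lemma fin_codim_UNIV: "fin_codim UNIV"
  unfolding fin_codim_def by (intro exI[of _ "{}"]) auto

lemma fin_codim_kernel: "linear (f :: 'a::real_vector \<Rightarrow> real) \<Longrightarrow> fin_codim {y. f y = 0}"
  unfolding fin_codim_def by (intro exI[of _ "{f}"]) auto

lemma fin_codim_Int:
  assumes "fin_codim Y" "fin_codim Z"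
  shows "fin_codim (Y \<inter> Z)"
proof -
  obtain \<Phi> where "finite \<Phi>" "\<forall>f\<in>\<Phi>. linear f" "Y = {y. \<forall>f\<in>\<Phi>. f y = (0::real)}"
    using assms(1) unfolding fin_codim_def by blast
  moreover obtain \<Psi> where "finite \<Psi>" "\<forall>f\<in>\<Psi>. linear f" "Z = {y. \<forall>f\<in>\<Psi>. f y = (0::real)}"
    using assms(2) unfolding fin_codim_def by blast
  ultimately show ?thesis
    unfolding fin_codim_def by (intro exI[of _ "\<Phi> \<union> \<Psi>"]) auto
qed

lemma fin_codim_INT:
  assumes "finite I" "\<And>i. i \<in> I \<Longrightarrow> fin_codim (Y i)"
  shows "fin_codim (\<Inter>i\<in>I. Y i)"
  using assms by (induction I) (simp_all add: fin_codim_UNIV fin_codim_Int)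

lemma subspace_fin_codim:
  assumes "fin_codim Y"
  shows "subspace Y"
proof -
  obtain \<Phi> where "\<forall>f\<in>\<Phi>. linear f" "Y = {y. \<forall>f\<in>\<Phi>. f y = (0::real)}"
    using assms unfolding fin_codim_def by blast
  then show ?thesis
    by (auto simp: subspace_def linear_add linear_cmul linear_0)
qed

lemma fin_codim_unit_vector:
  fixes Y :: "'a::real_normed_vector set"
  assumes Y: "fin_codim Y" and inf: "\<not> (\<exists>S::'a set. finite S \<and> span S = UNIV)"
  obtains y where "y \<in> Y" "norm y = 1"
proof -
  obtain \<Phi> where \<Phi>: "finite \<Phi>" "\<forall>f\<in>\<Phi>. linear f" "Y = {y. \<forall>f\<in>\<Phi>. f y = (0::real)}"
    using Y unfolding fin_codim_def by blast
  \<comment> \<open>Strengthened for the induction from "nonzero" to "in no finite-dimensional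
    span": passing to the kernel of \<open>f\<close> loses at most the one direction
    \<open>v\<close>.\<close>
  have "\<not> (\<exists>S. finite S \<and> {y. \<forall>f\<in>\<Phi>. f y = (0::real)} \<subseteq> span S)"
    using \<Phi>(1,2)
  proof (induction \<Phi>)
    case empty
    then show ?case
      using inf by auto
  next
    case (insert f \<Phi>)
    let ?V = "{y. \<forall>f\<in>\<Phi>. f y = 0}"
    have lin: "linear g" if "g \<in> insert f \<Phi>" for g
      using insert.prems that by blast
    show ?case
    proof
      assume "\<exists>S. finite S \<and> {y. \<forall>g\<in>insert f \<Phi>. g y = 0} \<subseteq> span S"
      then obtain S where S: "finite S" "{y. \<forall>g\<in>insert f \<Phi>. g y = 0} \<subseteq> span S"
        by blast
      have not_sub: "\<not> ?V \<subseteq> span S'" if "finite S'" for S'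
        using insert that by auto
      then obtain v where v: "v \<in> ?V" "f v \<noteq> 0"
        using S by blast
      have "?V \<subseteq> span (insert v S)"
      proof
        fix u assume u: "u \<in> ?V"
        have "u - (f u / f v) *\<^sub>R v \<in> {y. \<forall>g\<in>insert f \<Phi>. g y = 0}"
          using u v lin by (auto simp: linear_diff linear_cmul)
        then have "u - (f u / f v) *\<^sub>R v \<in> span S"
          using S by blast
        then show "u \<in> span (insert v S)"
          by (auto simp: span_insert)
      qed
      then show False
        using not_sub[of "insert v S"] S by simp
    qed
  qed
  then have "\<not> Y \<subseteq> span {}"
    using \<Phi>(3) by (metis finite.emptyI)
  then obtain y where y: "y \<in> Y" "y \<noteq> 0"
    by auto
  then have "sgn y \<in> Y"
    using subspace_fin_codim[OF Y] by (simp add: sgn_div_norm subspace_scale)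
  then show thesis
    using that[of "sgn y"] y by (simp add: norm_sgn)
qed

lemma fin_codim_orth:
  fixes N :: "'a::real_normed_vector set"
  assumes us: "uniformly_smooth TYPE('a)" and "finite N"
  obtains Y where "fin_codim Y" "\<And>v y. v \<in> N \<Longrightarrow> y \<in> Y \<Longrightarrow> v \<bottom>\<^sub>B y"
proof -
  have "\<exists>Y. fin_codim Y \<and> (\<forall>y\<in>Y. v \<bottom>\<^sub>B y)" for v :: 'a
  proof -
    obtain f :: "'a \<Rightarrow> real" where "linear f" "\<And>y. f y = 0 \<Longrightarrow> v \<bottom>\<^sub>B y"
      using smooth_support_functional[OF us] by blast
    then show ?thesis
      using fin_codim_kernel by blast
  qed
  then obtain Z where Z: "\<And>v::'a. fin_codim (Z v)" "\<And>v y. y \<in> Z v \<Longrightarrow> v \<bottom>\<^sub>B y"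
    by metis
  show thesis
    using that[of "\<Inter>v\<in>N. Z v"] fin_codim_INT[OF \<open>finite N\<close>] Z by auto
qed

text \<open>Exact orthogonality to a finite \<open>e/2\<close>-net suffices: replacing a vector by
  its net point costs \<open>e/2\<close> on each side.\<close>

lemma fin_codim_almost_orth:
  fixes D :: "'a::real_normed_vector set"
  assumes us: "uniformly_smooth TYPE('a)" and "compact D" and "e > 0"
  obtains Y where "fin_codim Y" "\<And>v y. v \<in> D \<Longrightarrow> y \<in> Y \<Longrightarrow> norm v \<le> norm (v + y) + e"
proof -
  obtain N where N: "finite N" "D \<subseteq> (\<Union>x\<in>N. ball x (e/2))"
    using \<open>compact D\<close> \<open>e > 0\<close> unfolding compact_eq_totally_bounded by (meson half_gt_zero)
  obtain Y where Y: "fin_codim Y" "\<And>v y. v \<in> N \<Longrightarrow> y \<in> Y \<Longrightarrow> v \<bottom>\<^sub>B y"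
    using fin_codim_orth[OF us N(1)] by blast
  have "norm v \<le> norm (v + y) + e" if vy: "v \<in> D" "y \<in> Y" for v y
  proof -
    obtain u where u: "u \<in> N" "norm (u - v) < e/2"
      using N vy by (auto simp: dist_norm)
    have "norm u \<le> norm (u + y)"
      using Y u vy birkhoff_orthD by blast
    moreover have "norm v \<le> norm u + norm (u - v)"
      using norm_triangle_ineq4[of u "u - v"] by simp
    moreover have "norm (u + y) \<le> norm (v + y) + norm (u - v)"
      using norm_triangle_ineq[of "v + y" "u - v"] by (simp add: add.commute)
    ultimately show ?thesis
      using u by linarith
  qed
  with Y show thesis
    using that by blast
qed

section \<open>Point-finite families of balls\<close>

locale point_finite_balls =
  fixes K :: "'k set" and c :: "'k \<Rightarrow> 'a::banach" and r :: "'k \<Rightarrow> real"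
  assumes rotund: "uniformly_rotund TYPE('a)" and smooth: "uniformly_smooth TYPE('a)"
    and infinite_dim: "\<not> (\<exists>S::'a set. finite S \<and> span S = UNIV)"
    and radius_pos: "k \<in> K \<Longrightarrow> r k > 0"
    and finite_balls_at: "finite {k \<in> K. norm (x - c k) \<le> r k}"
begin

section \<open>Radii near a point, and balls met deeply by a compact set\<close>

lemma no_point_in_large_balls:
  assumes "\<And>n. k n \<in> K" and "\<And>n. r (k n) > real n"
  shows "\<exists>N. \<forall>n\<ge>N. norm (x - c (k n)) > r (k n)"
proof (rule ccontr)
  assume "\<not> ?thesis"
  then have inf: "\<exists>n\<ge>N. norm (x - c (k n)) \<le> r (k n)" for N
    by (meson not_le)
  let ?F = "{j \<in> K. norm (x - c j) \<le> r j}"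
  obtain b where b: "\<And>j. j \<in> ?F \<Longrightarrow> r j \<le> b"
    using finite_balls_at[of x] by (metis (no_types, lifting) Max_ge finite_imageI imageI)
  obtain N where "b \<le> real N"
    using real_arch_simple by blast
  moreover obtain n where "n \<ge> N" "norm (x - c (k n)) \<le> r (k n)"
    using inf by blast
  ultimately show False
    using b[of "k n"] assms[of n] by force
qed

text \<open>Infinitely many huge balls accumulating at \<open>x\<close> look like half-spaces near \<open>x\<close>. If they
  come arbitrarily close to every point, Baire's theorem yields a point lying in infinitely many of
  them. If they stay away from a point \<open>w\<close>, then by smoothness they contain the reflection of \<open>w\<close>
  in \<open>x\<close>.\<close>

lemma radii_locally_bounded:
  obtains \<epsilon> R where "\<epsilon> > 0" and "\<And>k. k \<in> K \<Longrightarrow> norm (x - c k) < r k + \<epsilon> \<Longrightarrow> r k \<le> R"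
proof (rule ccontr)
  assume "\<not> thesis"
  then have "\<exists>k\<in>K. norm (x - c k) < r k + 1 / Suc n \<and> r k > real n" for n :: nat
    using that[of "1 / Suc n" "real n"] by (meson not_le of_nat_0_less_iff zero_less_Suc zero_less_divide_1_iff)
  then obtain k where kK: "\<And>n. k n \<in> K" and kx: "\<And>n. norm (x - c (k n)) < r (k n) + 1 / Suc n"
    and kr: "\<And>n. r (k n) > real n"
    by metis
  have fin: "\<exists>N. \<forall>n\<ge>N. norm (w - c (k n)) > r (k n)" for w
    using no_point_in_large_balls kK kr by blast
  show False
  proof (cases "\<forall>w e. e > 0 \<longrightarrow> (\<exists>N. \<forall>n\<ge>N. norm (w - c (k n)) < r (k n) + e)")
    case True
    define G where "G N = (\<Union>n\<in>{N..}. ball (c (k n)) (r (k n)))" for N :: nat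
    have op: "open (G N)" for N
      by (auto simp: G_def)
    have dense: "closure (G N) = UNIV" for N
    proof -
      have "\<exists>y\<in>G N. dist y w < e" if e: "e > 0" for w e
      proof -
        obtain M where M: "\<And>n. n \<ge> M \<Longrightarrow> norm (w - c (k n)) < r (k n) + e/2"
          using True e by (metis half_gt_zero)
        define n where "n = max M N"
        define d where "d = norm (w - c (k n))"
        have rn: "r (k n) > 0"
          using radius_pos kK by blast
        have dn: "d < r (k n) + e/2"
          using M[of n] by (simp add: n_def d_def)
        show ?thesis
        proof (cases "d < r (k n)")
          case True
          then have "w \<in> G N"
            by (auto simp: G_def d_def dist_norm norm_minus_commute n_def intro!: bexI[of _ n])
          then show ?thesis
            using e by force
        next
          case False
          then have d0: "d > 0"
            using rn by simp
          \<comment> \<open>Moving from \<open>w\<close> towards the centre by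
            \<open>3 * e / 4\<close> closes a gap of less than \<open>e/2\<close> and stays within
            \<open>e\<close>; the cap \<open>d\<close> stops at the centre.\<close>
          define s where "s = min d (3 * e / 4)"
          define y where "y = c (k n) + ((d - s) / d) *\<^sub>R (w - c (k n))"
          have s: "0 < s" "s < e" "s \<le> d" "d - s < r (k n)"
            using e d0 dn rn by (auto simp: s_def)
          have "norm (y - c (k n)) = d - s"
            using s d0 by (simp add: y_def d_def)
          then have "y \<in> G N"
            using s by (auto simp: G_def dist_norm norm_minus_commute n_def intro!: bexI[of _ n])
          moreover have "y - w = - ((s / d) *\<^sub>R (w - c (k n)))"
            using d0 by (simp add: y_def algebra_simps diff_divide_distrib)
          then have "norm (y - w) = s"
            using s d0 by (simp add: d_def)
          ultimately show ?thesis
            using s by (auto simp: dist_norm)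
        qed
      qed
      then show ?thesis
        by (auto simp: closure_approachable)
    qed
    have "euclidean closure_of (\<Inter>(range G)) = topspace euclidean"
    proof (rule Baire_category)
      show "completely_metrizable_space (euclidean :: 'a topology) \<or>
          locally_compact_space (euclidean :: 'a topology) \<and> regular_space (euclidean :: 'a topology)"
        using completely_metrizable_space_euclidean by blast
    qed (use op dense in auto)
    then have "\<Inter>(range G) \<noteq> {}"
      by auto
    then obtain w where "\<And>N. w \<in> G N"
      by auto
    moreover obtain N where "\<And>n. n \<ge> N \<Longrightarrow> norm (w - c (k n)) > r (k n)"
      using fin by blast
    ultimately show False
      by (force simp: G_def dist_norm norm_minus_commute)
  next
    case False
    then obtain w e where e: "e > 0" and far: "\<And>N. \<exists>n\<ge>N. norm (w - c (k n)) \<ge> r (k n) + e"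
      by (meson not_le)
    define h where "h = w - x"
    define \<epsilon> where "\<epsilon> = e / (2 * (norm h + 1))"
    have "\<epsilon> > 0"
      using e by (simp add: \<epsilon>_def add_nonneg_pos)
    then obtain \<tau> where \<tau>: "\<tau> > 0"
      and T: "\<And>u v::'a. norm v \<le> \<tau> * norm u \<Longrightarrow> norm (u + v) + norm (u - v) \<le> 2 * norm u + \<epsilon> * norm v"
      using smooth_norm_sum[OF smooth] by blast
    have "\<epsilon> * norm h \<le> \<epsilon> * (norm h + 1)"
      using \<open>\<epsilon> > 0\<close> by (intro mult_left_mono) auto
    also have "\<dots> = e/2"
    proof -
      have "norm h + 1 \<noteq> 0"
        using norm_ge_zero[of h] by linarith
      then show ?thesis
        unfolding \<epsilon>_def by (simp only: times_divide_eq_left mult.commute[of 2] mult_divide_mult_cancel_left_if mult.commute[of e]) simp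
    qed
    finally have eh: "\<epsilon> * norm h \<le> e/2" .
    obtain N where N: "\<And>n. n \<ge> N \<Longrightarrow> norm (x - h - c (k n)) > r (k n)"
      using fin by blast
    \<comment> \<open>\<open>N1\<close> makes the radius large enough for
      \<open>norm h \<le> \<tau> * norm (x - c (k n))\<close>; \<open>N2\<close> makes
      \<open>1 / Suc n\<close> at most \<open>e / 4\<close>.\<close>
    obtain N1 where N1: "norm h + norm h / \<tau> \<le> real N1"
      using real_arch_simple by blast
    obtain N2 where N2: "4 / e \<le> real N2"
      using real_arch_simple by blast
    obtain n where n: "n \<ge> max N (max N1 N2)" and nw: "norm (w - c (k n)) \<ge> r (k n) + e"
      using far by blast
    have "4 / e \<le> real (Suc n)"
      using N2 n by simp
    then have small: "1 / real (Suc n) \<le> e / 4"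
      using e by (simp add: field_simps)
    have "norm (w - c (k n)) \<le> norm (x - c (k n)) + norm h"
      using norm_triangle_ineq[of "x - c (k n)" h] by (simp add: h_def)
    then have "norm h / \<tau> \<le> norm (x - c (k n))"
      using nw kr[of n] e N1 n by (smt (verit, best) max.bounded_iff of_nat_le_iff)
    then have "norm h \<le> \<tau> * norm (x - c (k n))"
      using \<tau> by (simp add: field_simps)
    \<comment> \<open>\<open>w\<close> is outside the ball by at least \<open>e\<close>,
      \<open>x\<close> by at most \<open>e/4\<close>, and the error is at most \<open>e/2\<close>.
      Hence the reflected point \<open>x - h\<close> is in the ball, although
      \<open>n \<ge> N\<close>.\<close>
    from T[OF this] have "norm (w - c (k n)) + norm (x - h - c (k n)) \<le> 2 * norm (x - c (k n)) + \<epsilon> * norm h"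
      by (simp add: h_def algebra_simps)
    then have "norm (x - h - c (k n)) \<le> r (k n)"
      using nw kx[of n] small eh by linarith
    then show False
      using N[of n] n by simp
  qed
qed

text \<open>Violations at points \<open>q n\<close> with ever larger radii would accumulate at a
  limit point and contradict the local bound there.\<close>

lemma compact_radii_bounded:
  assumes "compact C"
  obtains \<epsilon> R where "\<epsilon> > 0" and "\<And>k q. k \<in> K \<Longrightarrow> q \<in> C \<Longrightarrow> norm (q - c k) < r k + \<epsilon> \<Longrightarrow> r k \<le> R"
proof (rule ccontr)
  assume "\<not> thesis"
  then have "\<exists>k q. k \<in> K \<and> q \<in> C \<and> norm (q - c k) < r k + 1 / Suc n \<and> r k > real n" for n :: nat
    using that[of "1 / Suc n" "real n"] by (meson not_le of_nat_0_less_iff zero_less_Suc zero_less_divide_1_iff)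
  then obtain k q where kK: "\<And>n. k n \<in> K" and qC: "\<And>n. q n \<in> C"
    and kx: "\<And>n. norm (q n - c (k n)) < r (k n) + 1 / Suc n" and kr: "\<And>n. r (k n) > real n"
    by metis
  obtain x \<phi> where \<phi>: "strict_mono (\<phi> :: nat \<Rightarrow> nat)" and lim: "(q \<circ> \<phi>) \<longlonglongrightarrow> x"
    using assms qC by (metis compact_def)
  obtain \<epsilon> R where \<epsilon>: "\<epsilon> > 0" and R: "\<And>k. k \<in> K \<Longrightarrow> norm (x - c k) < r k + \<epsilon> \<Longrightarrow> r k \<le> R"
    using radii_locally_bounded by blast
  have "\<forall>\<^sub>F n in sequentially. dist ((q \<circ> \<phi>) n) x < \<epsilon>/2"
    using tendstoD[OF lim, of "\<epsilon>/2"] \<epsilon> by simp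
  moreover have "\<forall>\<^sub>F n in sequentially. 1 / real (Suc n) < \<epsilon>/2"
    using order_tendstoD(2)[OF LIMSEQ_inverse_real_of_nat, of "\<epsilon>/2"] \<epsilon> by (simp add: inverse_eq_divide)
  moreover have "\<forall>\<^sub>F n in sequentially. R \<le> real n"
    by (rule eventually_sequentiallyI[of "nat \<lceil>R\<rceil>"]) linarith
  ultimately have "\<forall>\<^sub>F n in sequentially. False"
  proof eventually_elim
    case (elim n)
    have m: "\<phi> n \<ge> n"
      using \<phi> by (rule strict_mono_imp_increasing)
    then have "1 / real (Suc (\<phi> n)) \<le> 1 / real (Suc n)"
      by (simp add: field_simps)
    moreover have "norm (x - c (k (\<phi> n))) \<le> norm (q (\<phi> n) - c (k (\<phi> n))) + norm (x - q (\<phi> n))"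
      using norm_triangle_ineq[of "x - q (\<phi> n)" "q (\<phi> n) - c (k (\<phi> n))"] by simp
    ultimately have "norm (x - c (k (\<phi> n))) < r (k (\<phi> n)) + \<epsilon>"
      using kx[of "\<phi> n"] elim by (simp add: dist_norm norm_minus_commute)
    then have "r (k (\<phi> n)) \<le> R"
      using R kK by blast
    then show False
      using kr[of "\<phi> n"] m elim by linarith
  qed
  then show False
    by simp
qed

text \<open>Given infinitely many such balls, with points \<open>q n\<close> in them, a limit point
  of the \<open>q n\<close> would lie in infinitely many of the balls; the depth
  \<open>\<eta>\<close> pays for passing to the limit.\<close>

lemma finite_deep_balls:
  assumes "compact C" and \<eta>: "\<eta> > 0"
  shows "finite {k \<in> K. \<exists>q\<in>C. norm (q - c k) \<le> r k - \<eta>}" (is "finite ?D")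
proof (rule ccontr)
  assume "infinite ?D"
  then obtain k :: "nat \<Rightarrow> 'k" where k: "inj k" "range k \<subseteq> ?D"
    using infinite_countable_subset by blast
  then have "\<forall>n. \<exists>q\<in>C. norm (q - c (k n)) \<le> r (k n) - \<eta>"
    by blast
  then obtain q where qC: "\<And>n. q n \<in> C" and q: "\<And>n. norm (q n - c (k n)) \<le> r (k n) - \<eta>"
    by metis
  obtain x \<phi> where \<phi>: "strict_mono (\<phi> :: nat \<Rightarrow> nat)" and lim: "(q \<circ> \<phi>) \<longlonglongrightarrow> x"
    using assms qC by (metis compact_def)
  then obtain N where N: "\<And>n. n \<ge> N \<Longrightarrow> dist ((q \<circ> \<phi>) n) x < \<eta>"
    using \<eta> by (metis lim_sequentially)
  have "k (\<phi> n) \<in> {k \<in> K. norm (x - c k) \<le> r k}" if "n \<ge> N" for n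
    using N[OF that] q[of "\<phi> n"] k(2) norm_triangle_ineq[of "x - q (\<phi> n)" "q (\<phi> n) - c (k (\<phi> n))"]
    by (auto simp: dist_norm norm_minus_commute)
  then have "(k \<circ> \<phi>) ` {N..} \<subseteq> {k \<in> K. norm (x - c k) \<le> r k}"
    by auto
  then have "finite ((k \<circ> \<phi>) ` {N..})"
    using finite_balls_at finite_subset by blast
  moreover have "inj_on (k \<circ> \<phi>) {N..}"
    using k(1) \<phi> by (meson comp_inj_on inj_on_subset strict_mono_imp_inj_on subset_UNIV)
  ultimately show False
    using finite_imageD infinite_Ici by blast
qed

text \<open>\<open>G\<close> collects the old balls, a finite subcover of \<open>C\<close> and the
  balls met to depth \<open>\<eta>\<close>. Any other ball either has radius at most
  \<open>R\<close> and is met at most shallowly, so that \<open>rotund_exit\<close> applies, or is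
  \<open>\<epsilon>\<close> away from the point in question, and orthogonality alone
  suffices.\<close>

lemma compact_cover_stage:
  assumes "compact C" and G0: "finite G0" "G0 \<subseteq> K"
    and cover: "\<And>q. q \<in> C \<Longrightarrow> \<exists>k\<in>K. norm (q - c k) < r k"
  obtains G \<theta> where "finite G" "G0 \<subseteq> G" "G \<subseteq> K" "\<theta> > 0"
    and "\<And>k. k \<in> G \<Longrightarrow> k \<in> G0 \<or> (\<exists>q\<in>C. norm (q - c k) \<le> r k)"
    and "\<And>x q. q \<in> C \<Longrightarrow> norm (x - q) < \<theta> \<Longrightarrow> \<exists>k\<in>G. norm (x - c k) \<le> r k"
    and "\<And>L. finite L \<Longrightarrow> L \<subseteq> K - G \<Longrightarrow>
      \<exists>Y. fin_codim Y \<and> (\<forall>y\<in>Y. \<forall>q\<in>C. \<forall>k\<in>L. norm y \<ge> \<theta> \<longrightarrow> norm (q + y - c k) > r k)"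
proof -
  have "C \<subseteq> (\<Union>k\<in>K. ball (c k) (r k))"
    using cover by (fastforce simp: dist_norm norm_minus_commute)
  then obtain D where D: "D \<subseteq> K" "finite D" "C \<subseteq> (\<Union>k\<in>D. ball (c k) (r k))"
    using compactE_image[OF \<open>compact C\<close>, of K "\<lambda>k. ball (c k) (r k)"] by auto
  \<comment> \<open>A Lebesgue number of the cover. It is both the width of the covered
    neighbourhood and the length that forces an exit.\<close>
  obtain \<theta> where \<theta>: "\<theta> > 0" and leb: "\<forall>x\<in>C. \<exists>B\<in>(\<lambda>k. ball (c k) (r k)) ` D. ball x \<theta> \<subseteq> B"
    by (rule Heine_Borel_lemma[OF \<open>compact C\<close> D(3)]) auto
  obtain \<epsilon> R where \<epsilon>: "\<epsilon> > 0"
    and R: "\<And>k q. k \<in> K \<Longrightarrow> q \<in> C \<Longrightarrow> norm (q - c k) < r k + \<epsilon> \<Longrightarrow> r k \<le> R"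
    using compact_radii_bounded[OF \<open>compact C\<close>] by blast
  obtain \<eta>1 where \<eta>1: "\<eta>1 > 0"
    and exit: "\<And>(v::'a) y s. \<lbrakk>v \<bottom>\<^sub>B y; norm y \<ge> \<theta>; s \<le> R; norm v \<ge> s - \<eta>1\<rbrakk> \<Longrightarrow> norm (v + y) > s + \<eta>1"
    using rotund_exit[OF rotund \<theta>, of R] by blast
  define \<eta> where "\<eta> = min \<eta>1 (\<epsilon>/2)"
  have \<eta>: "\<eta> > 0" "\<eta> \<le> \<eta>1" "\<eta> < \<epsilon>"
    using \<epsilon> \<eta>1 by (auto simp: \<eta>_def)
  \<comment> \<open>Members of the subcover missing \<open>C\<close> are dropped; those selected by
    the Lebesgue number contain their point \<open>q\<close>, hence survive.\<close>
  define D1 where "D1 = {k \<in> D. \<exists>q\<in>C. norm (q - c k) \<le> r k}"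
  define D2 where "D2 = {k \<in> K. \<exists>q\<in>C. norm (q - c k) \<le> r k - \<eta>}"
  define G where "G = G0 \<union> D1 \<union> D2"
  have exitG: "norm (q - c k + y) > r k + \<eta>"
    if h: "k \<in> K - G" "q \<in> C" "q - c k \<bottom>\<^sub>B y" "norm y \<ge> \<theta>" for k q y
  proof (cases "r k \<le> R")
    case True
    have "norm (q - c k) \<ge> r k - \<eta>1"
      using h(1,2) \<eta> by (force simp: G_def D2_def)
    then show ?thesis
      using exit[OF h(3,4) True] \<eta> by linarith
  next
    case False
    then have "norm (q - c k) \<ge> r k + \<epsilon>"
      using R h by force
    then show ?thesis
      using birkhoff_orthD[OF h(3)] \<eta> by linarith
  qed
  show thesis
  proof
    show "finite G"
      using G0 D finite_deep_balls[OF \<open>compact C\<close> \<eta>(1)] by (auto simp: G_def D1_def D2_def)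
    show "G0 \<subseteq> G" "G \<subseteq> K"
      using G0 D by (auto simp: G_def D1_def D2_def)
    show "\<theta> > 0"
      by (rule \<theta>)
    show "k \<in> G0 \<or> (\<exists>q\<in>C. norm (q - c k) \<le> r k)" if "k \<in> G" for k
      using that \<eta> by (force simp: G_def D1_def D2_def)
    show "\<exists>k\<in>G. norm (x - c k) \<le> r k" if q: "q \<in> C" "norm (x - q) < \<theta>" for x q
    proof -
      obtain k where k: "k \<in> D" "ball q \<theta> \<subseteq> ball (c k) (r k)"
        using leb q by blast
      moreover have "x \<in> ball q \<theta>" "q \<in> ball q \<theta>"
        using q \<theta> by (auto simp: dist_norm norm_minus_commute)
      ultimately have "x \<in> ball (c k) (r k)" "q \<in> ball (c k) (r k)"
        by blast+
      then have "norm (x - c k) \<le> r k" "norm (q - c k) \<le> r k"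
        by (auto simp: dist_norm norm_minus_commute)
      then show ?thesis
        using k q by (auto simp: G_def D1_def)
    qed
    show "\<exists>Y. fin_codim Y \<and> (\<forall>y\<in>Y. \<forall>q\<in>C. \<forall>k\<in>L. norm y \<ge> \<theta> \<longrightarrow> norm (q + y - c k) > r k)"
      if L: "finite L" "L \<subseteq> K - G" for L
    proof -
      \<comment> \<open>Only the finitely many vectors from centres of \<open>L\<close> to net
        points are made orthogonal; the surplus \<open>\<eta>\<close> in \<open>exitG\<close>
        absorbs the distance to the net.\<close>
      obtain N where N: "finite N" "N \<subseteq> C" "C \<subseteq> (\<Union>x\<in>N. ball x \<eta>)"
        using seq_compact_imp_totally_bounded[of C] \<open>compact C\<close> \<eta>(1)
        by (metis compact_eq_seq_compact_metric)
      have "finite ((\<lambda>(q, k). q - c k) ` (N \<times> L))"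
        using N L by blast
      then obtain Y where Y: "fin_codim Y"
        and orth: "\<And>v y. v \<in> (\<lambda>(q, k). q - c k) ` (N \<times> L) \<Longrightarrow> y \<in> Y \<Longrightarrow> v \<bottom>\<^sub>B y"
        using fin_codim_orth[OF smooth] by blast
      have "norm (q + y - c k) > r k" if y: "y \<in> Y" "q \<in> C" "k \<in> L" "norm y \<ge> \<theta>" for y q k
      proof -
        obtain p where p: "p \<in> N" "norm (p - q) < \<eta>"
          using N y by (auto simp: dist_norm)
        have "p - c k \<bottom>\<^sub>B y"
          using p y by (intro orth) auto
        then have "norm (p - c k + y) > r k + \<eta>"
          using p y L N by (intro exitG) auto
        moreover have "norm (p - c k + y) \<le> norm (q + y - c k) + norm (p - q)"
          using norm_triangle_ineq[of "q + y - c k" "p - q"] by (simp add: algebra_simps)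
        ultimately show ?thesis
          using p by linarith
      qed
      with Y show ?thesis by blast
    qed
  qed
qed

text \<open>Koenig's lemma selects one ball from every level such that the selected balls have the
  finite intersection property.\<close>

lemma finite_levels_impossible:
  fixes L :: "nat \<Rightarrow> 'k set"
  assumes fin: "\<And>m. finite (L m)" and sub: "\<And>m. L m \<subseteq> K"
    and disj: "\<And>m n. m \<noteq> n \<Longrightarrow> L m \<inter> L n = {}"
    and meet: "\<And>M. \<exists>x. \<forall>m\<le>M. \<exists>k\<in>L m. norm (x - c k) \<le> r k"
  shows False
proof -
  \<comment> \<open>The point may depend on \<open>M\<close>. This is what lets one of the finitely
    many balls of the next level inherit the property.\<close>
  define good where "good n g \<longleftrightarrow> (\<forall>M. \<exists>x. (\<forall>m<n. norm (x - c (g m)) \<le> r (g m)) \<and>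
      (\<forall>m\<le>M. \<exists>k\<in>L m. norm (x - c k) \<le> r k))" for n and g :: "nat \<Rightarrow> 'k"
  have step: "\<exists>k\<in>L n. good (Suc n) (g(n := k))" if g: "good n g" for n g
  proof (rule ccontr)
    assume "\<not> ?thesis"
    then have "\<forall>k\<in>L n. \<exists>M. \<not> (\<exists>x. (\<forall>m<Suc n. norm (x - c ((g(n := k)) m)) \<le> r ((g(n := k)) m)) \<and>
      (\<forall>m\<le>M. \<exists>k\<in>L m. norm (x - c k) \<le> r k))"
      unfolding good_def by blast
    then obtain B where B: "\<And>k x. k \<in> L n \<Longrightarrow> \<not> ((\<forall>m<Suc n. norm (x - c ((g(n := k)) m)) \<le> r ((g(n := k)) m)) \<and>
      (\<forall>m\<le>B k. \<exists>k\<in>L m. norm (x - c k) \<le> r k))"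
      by metis
    \<comment> \<open>If every choice \<open>k\<close> failed, it would do so at some depth
      \<open>B k\<close>; a point good for the maximal depth refutes one of these failures.
      Including \<open>n\<close> guarantees that this point meets level \<open>n\<close>.\<close>
    define M where "M = Max (insert n (B ` L n))"
    have M: "n \<le> M" "\<And>k. k \<in> L n \<Longrightarrow> B k \<le> M"
      using fin[of n] by (auto simp: M_def)
    obtain x where x: "\<forall>m<n. norm (x - c (g m)) \<le> r (g m)" "\<forall>m\<le>M. \<exists>k\<in>L m. norm (x - c k) \<le> r k"
      using g unfolding good_def by blast
    then obtain k where k: "k \<in> L n" "norm (x - c k) \<le> r k"
      using M by blast
    have "\<forall>m<Suc n. norm (x - c ((g(n := k)) m)) \<le> r ((g(n := k)) m)"
      using x k by (auto simp: less_Suc_eq)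
    then show False
      using B[OF k(1), of x] x(2) M(2)[OF k(1)] by (meson order_trans)
  qed
  have "\<exists>h. \<forall>n. good n (h n) \<and> (\<exists>k\<in>L n. h (Suc n) = (h n)(n := k))"
  proof (rule dependent_nat_choice)
    show "\<exists>g. good 0 g"
      using meet by (auto simp: good_def)
    show "\<And>g n. good n g \<Longrightarrow> \<exists>g'. good (Suc n) g' \<and> (\<exists>k\<in>L n. g' = g(n := k))"
      using step by blast
  qed
  then obtain h where h: "\<And>n. good n (h n)" "\<And>n. \<exists>k\<in>L n. h (Suc n) = (h n)(n := k)"
    by blast
  define g where "g m = h (Suc m) m" for m
  have gL: "g m \<in> L m" for m
    using h(2)[of m] by (auto simp: g_def)
  have hg: "h n m = g m" if "m < n" for m n
    using that
  proof (induction n)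
    case (Suc n)
    then show ?case
      using h(2)[of n] by (cases "m = n") (auto simp: g_def)
  qed simp
  have "(\<Inter>n. \<Inter>m\<in>{..n}. cball (c (g m)) (r (g m))) \<noteq> {}"
  proof (rule rotund_decreasing_Inter[OF rotund])
    fix n
    obtain x where "\<forall>m<Suc n. norm (x - c (h (Suc n) m)) \<le> r (h (Suc n) m)"
      using h(1)[of "Suc n"] unfolding good_def by blast
    then have "\<forall>m\<le>n. norm (x - c (g m)) \<le> r (g m)"
      using hg by (simp add: less_Suc_eq_le)
    then have "x \<in> (\<Inter>m\<in>{..n}. cball (c (g m)) (r (g m)))"
      by (auto simp: dist_norm norm_minus_commute)
    then show "(\<Inter>m\<in>{..n}. cball (c (g m)) (r (g m))) \<noteq> {}"
      by blast
  qed (auto intro: convex_INT)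
  then obtain x where "x \<in> (\<Inter>n. \<Inter>m\<in>{..n}. cball (c (g m)) (r (g m)))"
    by blast
  then have "x \<in> cball (c (g m)) (r (g m))" for m
    by blast
  then have x: "norm (x - c (g m)) \<le> r (g m)" for m
    by (auto simp: dist_norm norm_minus_commute)
  then have "range g \<subseteq> {k \<in> K. norm (x - c k) \<le> r k}"
    using gL sub by blast
  then have "finite (range g)"
    using finite_balls_at finite_subset by blast
  moreover have "inj g"
    using gL disj by (intro injI) (metis IntI empty_iff)
  ultimately show False
    using finite_imageD infinite_UNIV_nat by blast
qed

section \<open>Directions, levels and labels near a point\<close>

lemma compact_add_segment:
  fixes D :: "'a set"
  assumes "compact D"
  shows "compact {v + t *\<^sub>R y | v t. v \<in> D \<and> t \<in> {0..b}}"
proof -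
  have "{v + t *\<^sub>R y | v t. v \<in> D \<and> t \<in> {0..b}} = (\<lambda>(v, t). v + t *\<^sub>R y) ` (D \<times> {0..b})"
    by (auto, blast)
  moreover have "compact ((\<lambda>(v, t). v + t *\<^sub>R y) ` (D \<times> {0..b}))"
    using assms by (intro compact_continuous_image compact_Times)
      (auto simp: case_prod_unfold intro!: continuous_intros)
  ultimately show ?thesis by simp
qed

text \<open>Directions \<open>y n\<close> are chosen one after the other, each almost orthogonal to everything chosen
  before. \<open>G n\<close> is a finite set of balls covering the \<open>\<theta> n\<close>-neighbourhood of the part \<open>cut (D n)\<close>
  reached by the first \<open>n\<close> directions. A ball that is new in \<open>G (Suc n)\<close> meets \<open>cut (D n)\<close> at most
  shallowly, so by rotundity the directions chosen later leave it within distance \<open>\<theta> n\<close>. Hence a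
  point outside that neighbourhood whose coordinate \<open>n\<close> vanishes lies in no new ball, which is the
  boundary condition of Sperner's lemma. The labels at distance more than \<open>a\<close> from \<open>z\<close> are
  artificial, but harmless: they are nonzero, and the balls with label \<open>0\<close> stay within distance \<open>a\<close>.\<close>

lemma no_local_cover:
  assumes a: "a > 0" and Y0: "fin_codim Y0"
    and cov: "\<And>y. y \<in> Y0 \<Longrightarrow> norm y \<le> 2 * a \<Longrightarrow> \<exists>k\<in>K. norm (z + y - c k) < r k"
    and leave: "\<And>y k. \<lbrakk>y \<in> Y0; norm y \<ge> a; k \<in> K; norm (z - c k) \<le> r k\<rbrakk> \<Longrightarrow> norm (z + y - c k) > r k"
  shows False
proof -
  note sY0 = subspace_fin_codim[OF Y0]
  \<comment> \<open>If \<open>s j = b\<close>, two consecutive partial sums differ by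
    \<open>5 * a\<close> in norm. When \<open>norm (pt s) \<le> a\<close>, both have norm at most
    \<open>2 * a\<close>, so this cannot happen.\<close>
  define b where "b = 5 * a"
  define cut where "cut D = (+) z ` (D \<inter> cball 0 (2 * a))" for D
  define near where "near D G \<theta> \<longleftrightarrow> (\<forall>x. \<forall>q\<in>cut D. norm (x - q) < \<theta> \<longrightarrow> (\<exists>k\<in>G. norm (x - c k) \<le> r k))" for D G \<theta>
  define avoid where "avoid D L \<theta> Y \<longleftrightarrow> (\<forall>y\<in>Y. \<forall>q\<in>cut D. \<forall>k\<in>L. norm y \<ge> \<theta> \<longrightarrow> norm (q + y - c k) > r k)" for D L \<theta> Y
  \<comment> \<open>\<open>W\<close> is the space for this and all later directions,
    \<open>y\<close> the direction chosen from it. The last clause lets \<open>leave\<close> act on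
    the balls of level 0.\<close>
  define valid where "valid n s \<longleftrightarrow> (case s of (D, G, \<theta>, W, y) \<Rightarrow>
      compact D \<and> D \<subseteq> Y0 \<and> finite G \<and> G \<subseteq> K \<and> \<theta> > 0 \<and> near D G \<theta> \<and>
      (\<forall>L. finite L \<longrightarrow> L \<subseteq> K - G \<longrightarrow> (\<exists>Y. fin_codim Y \<and> avoid D L \<theta> Y)) \<and>
      fin_codim W \<and> W \<subseteq> Y0 \<and> (\<forall>v\<in>D. \<forall>w\<in>W. norm v \<le> norm (v + w) + a) \<and> y \<in> W \<and> norm y = 1 \<and>
      (n = 0 \<longrightarrow> 0 \<in> D \<and> (\<forall>k\<in>G. norm (z - c k) \<le> r k)))"
    for n :: nat and s :: "'a set \<times> 'k set \<times> real \<times> 'a set \<times> 'a"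
  define extends where "extends s s' \<longleftrightarrow> (case s of (D, G, \<theta>, W, y) \<Rightarrow> case s' of (D', G', \<theta>', W', y') \<Rightarrow>
      D' = {v + t *\<^sub>R y | v t. v \<in> D \<and> t \<in> {0..b}} \<and> G \<subseteq> G' \<and> W' \<subseteq> W \<and> avoid D (G' - G) \<theta> W')"
    for s s' :: "'a set \<times> 'k set \<times> real \<times> 'a set \<times> 'a"
  have stage: "\<exists>G' \<theta>'. finite G' \<and> G \<subseteq> G' \<and> G' \<subseteq> K \<and> \<theta>' > 0 \<and>
      (\<forall>k\<in>G'. k \<in> G \<or> (\<exists>q\<in>cut D. norm (q - c k) \<le> r k)) \<and> near D G' \<theta>' \<and>
      (\<forall>L. finite L \<longrightarrow> L \<subseteq> K - G' \<longrightarrow> (\<exists>Y. fin_codim Y \<and> avoid D L \<theta>' Y))"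
    if D: "compact D" "D \<subseteq> Y0" and G: "finite G" "G \<subseteq> K" for D G
  proof -
    have cpt: "compact (cut D)"
      unfolding cut_def using D by (intro compact_translation compact_Int_closed closed_cball)
    have cv: "\<exists>k\<in>K. norm (q - c k) < r k" if "q \<in> cut D" for q
      using that D cov by (auto simp: cut_def)
    show ?thesis
    proof (rule compact_cover_stage[OF cpt G cv])
      fix G' \<theta>
      assume "finite G'" "G \<subseteq> G'" "G' \<subseteq> K" "\<theta> > 0"
        "\<And>k. k \<in> G' \<Longrightarrow> k \<in> G \<or> (\<exists>q\<in>cut D. norm (q - c k) \<le> r k)"
        "\<And>x q. q \<in> cut D \<Longrightarrow> norm (x - q) < \<theta> \<Longrightarrow> \<exists>k\<in>G'. norm (x - c k) \<le> r k"
        "\<And>L. finite L \<Longrightarrow> L \<subseteq> K - G' \<Longrightarrow>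
          \<exists>Y. fin_codim Y \<and> (\<forall>y\<in>Y. \<forall>q\<in>cut D. \<forall>k\<in>L. \<theta> \<le> norm y \<longrightarrow> r k < norm (q + y - c k))"
      then show ?thesis
        unfolding near_def avoid_def by (intro exI[of _ G'] exI[of _ \<theta>] conjI allI ballI impI) simp_all
    qed
  qed
  have "\<exists>S. \<forall>n. valid n (S n) \<and> extends (S n) (S (Suc n))"
  proof (rule dependent_nat_choice)
    have "compact {0 :: 'a}" "{0} \<subseteq> Y0"
      using sY0 by (simp_all add: subspace_0)
    from stage[OF this finite.emptyI empty_subsetI]
    obtain G \<theta> where G: "finite G" "{} \<subseteq> G" "G \<subseteq> K" "\<theta> > 0"
      "\<forall>k\<in>G. k \<in> {} \<or> (\<exists>q\<in>cut {0}. norm (q - c k) \<le> r k)" "near {0} G \<theta>"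
      "\<forall>L. finite L \<longrightarrow> L \<subseteq> K - G \<longrightarrow> (\<exists>Y. fin_codim Y \<and> avoid {0} L \<theta> Y)"
      by (elim exE conjE) (rule that)
    obtain Y where Y: "fin_codim Y" "\<And>v y. v \<in> {0 :: 'a} \<Longrightarrow> y \<in> Y \<Longrightarrow> norm v \<le> norm (v + y) + a"
      by (rule fin_codim_almost_orth[OF smooth compact_sing[of 0] a], rule that)
    obtain y where y: "y \<in> Y0 \<inter> Y" "norm y = 1"
      by (rule fin_codim_unit_vector[OF fin_codim_Int[OF Y0 Y(1)] infinite_dim], rule that)
    have "\<forall>k\<in>G. norm (z - c k) \<le> r k"
      using G(5) by (auto simp: cut_def)
    then have "valid 0 ({0}, G, \<theta>, Y0 \<inter> Y, y)"
      unfolding valid_def prod.case using G Y y fin_codim_Int[OF Y0 Y(1)] sY0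
      by (intro conjI impI) (simp_all add: subspace_0)
    then show "\<exists>s. valid 0 s" ..
  next
    fix s n assume "valid n s"
    obtain D G \<theta> W y where s: "s = (D, G, \<theta>, W, y)"
      by (metis prod_cases5)
    with \<open>valid n s\<close> have I: "compact D" "D \<subseteq> Y0" "finite G" "G \<subseteq> K"
      "\<forall>L. finite L \<longrightarrow> L \<subseteq> K - G \<longrightarrow> (\<exists>Y. fin_codim Y \<and> avoid D L \<theta> Y)"
      "fin_codim W" "W \<subseteq> Y0" "y \<in> W"
      by (simp_all add: valid_def)
    define D' where "D' = {v + t *\<^sub>R y | v t. v \<in> D \<and> t \<in> {0..b}}"
    have D': "compact D'" "D' \<subseteq> Y0"
      using I compact_add_segment sY0 by (auto simp: D'_def subspace_add subspace_scale subset_iff)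
    from stage[OF D' I(3,4)]
    obtain G' \<theta>' where G': "finite G'" "G \<subseteq> G'" "G' \<subseteq> K" "\<theta>' > 0"
      "\<forall>k\<in>G'. k \<in> G \<or> (\<exists>q\<in>cut D'. norm (q - c k) \<le> r k)" "near D' G' \<theta>'"
      "\<forall>L. finite L \<longrightarrow> L \<subseteq> K - G' \<longrightarrow> (\<exists>Y. fin_codim Y \<and> avoid D' L \<theta>' Y)"
      by (elim exE conjE) (rule that)
    obtain Y1 where Y1: "fin_codim Y1" "avoid D (G' - G) \<theta> Y1"
      using I(5)[rule_format, of "G' - G"] G'(1,3) by blast
    obtain Y2 where Y2: "fin_codim Y2" "\<And>v y. v \<in> D' \<Longrightarrow> y \<in> Y2 \<Longrightarrow> norm v \<le> norm (v + y) + a"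
      by (rule fin_codim_almost_orth[OF smooth D'(1) a], rule that)
    \<comment> \<open>\<open>W\<close> keeps the spaces nested, \<open>Y1\<close> makes later
      directions leave the newly added balls, and \<open>Y2\<close> gives almost orthogonality to
      \<open>D'\<close>.\<close>
    define W' where "W' = W \<inter> (Y1 \<inter> Y2)"
    have W': "fin_codim W'"
      unfolding W'_def using I Y1 Y2 by (intro fin_codim_Int)
    obtain y' where y': "y' \<in> W'" "norm y' = 1"
      by (rule fin_codim_unit_vector[OF W' infinite_dim], rule that)
    have "valid (Suc n) (D', G', \<theta>', W', y')"
      unfolding valid_def prod.case using D' G' W' Y2 y' I
      by (intro conjI impI) (auto simp: W'_def)
    moreover have "extends s (D', G', \<theta>', W', y')"
      unfolding extends_def s using G' Y1 by (auto simp: W'_def D'_def avoid_def)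
    ultimately show "\<exists>s'. valid (Suc n) s' \<and> extends s s'"
      by blast
  qed
  then obtain S where S: "\<And>n. valid n (S n)" "\<And>n. extends (S n) (S (Suc n))"
    by blast
  define D where "D n = fst (S n)" for n
  define G where "G n = fst (snd (S n))" for n
  define \<theta> where "\<theta> n = fst (snd (snd (S n)))" for n
  define W where "W n = fst (snd (snd (snd (S n))))" for n
  define y where "y n = snd (snd (snd (snd (S n))))" for n
  have Sn: "S n = (D n, G n, \<theta> n, W n, y n)" for n
    by (simp add: D_def G_def \<theta>_def W_def y_def)
  have D: "compact (D n)" "D n \<subseteq> Y0" and G: "finite (G n)" "G n \<subseteq> K" and \<theta>: "\<theta> n > 0"
    and near: "near (D n) (G n) (\<theta> n)" and W: "fin_codim (W n)" "W n \<subseteq> Y0"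
    and almost: "\<And>v w. v \<in> D n \<Longrightarrow> w \<in> W n \<Longrightarrow> norm v \<le> norm (v + w) + a"
    and yW: "y n \<in> W n" and y1: "norm (y n) = 1" for n
    using S(1)[of n] by (auto simp: valid_def Sn)
  have D0: "0 \<in> D 0" and G0: "\<And>k. k \<in> G 0 \<Longrightarrow> norm (z - c k) \<le> r k"
    using S(1)[of 0] by (auto simp: valid_def Sn)
  have DS: "D (Suc n) = {v + t *\<^sub>R y n | v t. v \<in> D n \<and> t \<in> {0..b}}" and GS: "G n \<subseteq> G (Suc n)"
    and WS: "W (Suc n) \<subseteq> W n" and avoid: "avoid (D n) (G (Suc n) - G n) (\<theta> n) (W (Suc n))" for n
    using S(2)[of n] by (auto simp: extends_def Sn)
  have Gmono: "G m \<subseteq> G n" if "m \<le> n" for m n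
    using that GS by (rule lift_Suc_mono_le[rotated])
  have Wanti: "W n \<subseteq> W m" if "m \<le> n" for m n
    using that WS by (rule lift_Suc_antimono_le[rotated])
  have sumW: "(\<Sum>i\<in>I. s i *\<^sub>R y i) \<in> W n" if "\<And>i. i \<in> I \<Longrightarrow> n \<le> i" for I n and s :: "nat \<Rightarrow> real"
    using that subspace_fin_codim[OF W(1)[of n]] yW Wanti
    by (intro subspace_sum subspace_scale) blast+
  have sumD: "(\<Sum>i<n. s i *\<^sub>R y i) \<in> D n" if "\<And>i. i < n \<Longrightarrow> 0 \<le> s i \<and> s i \<le> b" for n and s :: "nat \<Rightarrow> real"
    using that
  proof (induction n)
    case (Suc n)
    then show ?case
      unfolding DS by (auto intro!: exI[of _ "\<Sum>i<n. s i *\<^sub>R y i"] exI[of _ "s n"])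
  qed (simp add: D0)
  define L where "L n = (if n = 0 then G 0 else G n - G (n - 1))" for n
  have L0: "L 0 = G 0" and LS: "L (Suc n) = G (Suc n) - G n" for n
    by (simp_all add: L_def)
  have LG: "L n \<subseteq> G n" for n
    by (auto simp: L_def)
  have GL: "\<exists>m\<le>n. k \<in> L m" if "k \<in> G n" for k n
  proof -
    define m where "m = (LEAST m. k \<in> G m)"
    have "k \<in> G m" "m \<le> n"
      using that unfolding m_def by (auto intro: LeastI Least_le)
    moreover have "k \<notin> G (m - 1)" if "m \<noteq> 0"
      using not_less_Least[of "m - 1" "\<lambda>m. k \<in> G m"] that by (simp add: m_def)
    ultimately show ?thesis
      by (intro exI[of _ m]) (auto simp: L_def)
  qed
  have meet: "\<exists>x. \<forall>m\<le>M. \<exists>k\<in>L m. norm (x - c k) \<le> r k" for M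
  proof -
    define pt where "pt s = (\<Sum>j<M. s j *\<^sub>R y j)" for s :: "nat \<Rightarrow> real"
    define box where "box s \<longleftrightarrow> (\<forall>j<M. 0 \<le> s j \<and> s j \<le> b)" for s :: "nat \<Rightarrow> real"
    have ptD: "pt s \<in> D M" if "box s" for s
      using that unfolding pt_def box_def by (intro sumD) auto
    have split: "pt s = (\<Sum>i<j. s i *\<^sub>R y i) + (\<Sum>i\<in>{j..<M}. s i *\<^sub>R y i)" if "j \<le> M" for s j
      using that by (simp add: pt_def sum.atLeastLessThan_concat flip: atLeast0LessThan)
    have headD: "(\<Sum>i<j. s i *\<^sub>R y i) \<in> D j" if "box s" "j \<le> M" for s j
      using that unfolding box_def by (intro sumD) auto
    \<comment> \<open>A partial sum lies in \<open>D j\<close> and the rest in \<open>W j\<close>,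
      so almost orthogonality bounds it by the whole.\<close>
    have head: "norm (\<Sum>i<j. s i *\<^sub>R y i) \<le> norm (pt s) + a" if "box s" "j \<le> M" for s j
      unfolding split[OF that(2)] using headD[OF that] sumW[of "{j..<M}" j] by (intro almost) auto
    define label where "label s l \<longleftrightarrow> l \<le> M \<and> (\<forall>j<M. s j = 0 \<longrightarrow> l \<noteq> Suc j) \<and> (\<forall>j<M. s j = b \<longrightarrow> Suc j \<le> l) \<and>
        (norm (pt s) \<le> a \<longrightarrow> (\<exists>k\<in>L l. norm (z + pt s - c k) \<le> r k)) \<and> (norm (pt s) > a \<longrightarrow> l \<noteq> 0)" for s l
    have ex_label: "\<exists>l. label s l" if s: "box s" for s
    proof (cases "norm (pt s) \<le> a")
      case True
      \<comment> \<open>The least such \<open>n\<close> supplies a ball of \<open>G n\<close>, while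
        for smaller indices the point is known to be outside the covered neighbourhood.\<close>
      define tube where "tube n \<longleftrightarrow> (\<exists>v\<in>D n. norm v \<le> 2 * a \<and> norm (pt s - v) < \<theta> n)" for n
      have "tube M"
        unfolding tube_def using ptD[OF s] True a \<theta> by (intro bexI[of _ "pt s"]) auto
      define n where "n = (LEAST n. tube n)"
      have n: "tube n" "n \<le> M"
        using \<open>tube M\<close> unfolding n_def by (auto intro: LeastI Least_le)
      have n_least: "\<not> tube m" if "m < n" for m
        using that not_less_Least unfolding n_def by blast
      obtain v where v: "v \<in> D n" "norm v \<le> 2 * a" "norm (pt s - v) < \<theta> n"
        using n unfolding tube_def by blast
      then have "z + v \<in> cut (D n)" "norm (z + pt s - (z + v)) < \<theta> n"
        by (auto simp: cut_def)
      then obtain k where k: "k \<in> G n" "norm (z + pt s - c k) \<le> r k"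
        using near[of n] unfolding near_def by blast
      then obtain m where m: "m \<le> n" "k \<in> L m"
        using GL by blast
      have "m \<noteq> Suc j" if j: "j < M" "s j = 0" for j
      proof
        assume mj: "m = Suc j"
        define u where "u = (\<Sum>i<j. s i *\<^sub>R y i)"
        define w where "w = (\<Sum>i\<in>{Suc j..<M}. s i *\<^sub>R y i)"
        \<comment> \<open>Since \<open>s j = 0\<close>, the head up to \<open>Suc j\<close> already
          lies in \<open>D j\<close>, and the tail lies in \<open>W (Suc j)\<close>, whose long
          vectors leave the balls of \<open>L (Suc j)\<close>.\<close>
        have uw: "pt s = u + w"
          using split[of "Suc j" s] j by (simp add: u_def w_def)
        have u: "u \<in> D j" "norm u \<le> 2 * a"
          using headD[OF s, of j] head[OF s, of j] j True by (auto simp: u_def)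
        have w: "w \<in> W (Suc j)"
          unfolding w_def by (intro sumW) auto
        have "\<not> norm w < \<theta> j"
          using n_least[of j] m mj u uw unfolding tube_def by force
        moreover have "z + u \<in> cut (D j)"
          using u by (auto simp: cut_def)
        ultimately have "norm (z + u + w - c k) > r k"
          using avoid[of j] w m mj LS unfolding avoid_def by (metis linorder_not_less)
        then show False
          using k uw by (simp add: add.assoc)
      qed
      moreover have "s j \<noteq> b" if j: "j < M" for j
      proof
        assume "s j = b"
        then have "(\<Sum>i<Suc j. s i *\<^sub>R y i) - (\<Sum>i<j. s i *\<^sub>R y i) = b *\<^sub>R y j"
          by simp
        then have "norm (b *\<^sub>R y j) \<le> norm (\<Sum>i<Suc j. s i *\<^sub>R y i) + norm (\<Sum>i<j. s i *\<^sub>R y i)"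
          by (metis norm_triangle_ineq4)
        then have "b \<le> norm (\<Sum>i<Suc j. s i *\<^sub>R y i) + norm (\<Sum>i<j. s i *\<^sub>R y i)"
          using y1[of j] a by (simp add: b_def)
        then show False
          using head[OF s, of j] head[OF s, of "Suc j"] j True a by (simp add: b_def)
      qed
      ultimately have "label s m"
        unfolding label_def using m n k True by auto
      then show ?thesis ..
    next
      case False
      \<comment> \<open>Far from \<open>z\<close> the label is one more than the last index with a
        positive coordinate, which satisfies both boundary rules.\<close>
      define J where "J = {j. j < M \<and> s j > 0}"
      have "J \<noteq> {}"
      proof
        assume "J = {}"
        then have "s j = 0" if "j < M" for j
          using that s by (force simp: J_def box_def)
        then have "pt s = 0"
          by (simp add: pt_def)
        then show False
          using False a by simp
      qed
      have J: "finite J"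
        by (auto simp: J_def)
      then have "Max J \<in> J"
        using \<open>J \<noteq> {}\<close> by simp
      moreover have "j \<le> Max J" if "j < M" "s j = b" for j
        using that J a by (intro Max_ge) (auto simp: J_def b_def)
      ultimately have "label s (Suc (Max J))"
        unfolding label_def using False by (auto simp: J_def)
      then show ?thesis ..
    qed
    define f where "f s = (SOME l. label s l)" for s
    have f: "label s (f s)" if "box s" for s
      unfolding f_def using ex_label[OF that] by (rule someI_ex)
    have "\<exists>X. \<forall>m\<le>M. box (X m) \<and> f (X m) = m \<and> (\<forall>j<M. \<bar>X m j - X 0 j\<bar> \<le> b / Suc N)" for N
    proof -
      define sc where "sc x j = b * real (x j) / Suc N" for x :: "nat \<Rightarrow> nat" and j
      have b: "b > 0"
        using a by (simp add: b_def)
      have box: "box (sc x)" if "\<And>j. j < M \<Longrightarrow> x j \<le> Suc N" for x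
        unfolding box_def
      proof (intro allI impI)
        fix j assume "j < M"
        then have "b * real (x j) \<le> b * real (Suc N)"
          using that b by (intro mult_left_mono of_nat_mono) auto
        then show "0 \<le> sc x j \<and> sc x j \<le> b"
          using b by (simp only: sc_def pos_divide_le_eq of_nat_0_less_iff zero_less_Suc) simp
      qed
      have "\<exists>b. \<forall>m\<le>M. \<exists>x. (\<forall>j<M. x j \<le> Suc N \<and> b j \<le> x j \<and> x j \<le> Suc (b j)) \<and> f (sc x) = m"
      proof (rule cube_sperner[of "Suc N" M "\<lambda>x. f (sc x)"])
        fix x :: "nat \<Rightarrow> nat" assume x: "\<And>j. j < M \<Longrightarrow> x j \<le> Suc N"
        have lab: "label (sc x) (f (sc x))"
          using f[OF box[OF x]] .
        then show "f (sc x) \<le> M"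
          by (simp add: label_def)
        fix j assume j: "j < M"
        show "f (sc x) \<noteq> Suc j" if "x j = 0"
          using lab j that unfolding label_def by (simp add: sc_def)
        show "Suc j \<le> f (sc x)" if "x j = Suc N"
        proof -
          have "sc x j = b"
            using that by (simp add: sc_def)
          then show ?thesis
            using lab j unfolding label_def by blast
        qed
      qed auto
      then obtain \<beta> X where X: "\<And>m. m \<le> M \<Longrightarrow> (\<forall>j<M. X m j \<le> Suc N \<and> \<beta> j \<le> X m j \<and> X m j \<le> Suc (\<beta> j)) \<and> f (sc (X m)) = m"
        by metis
      have "\<bar>sc (X m) j - sc (X 0) j\<bar> \<le> b / Suc N" if "m \<le> M" "j < M" for m j
      proof -
        have "\<bar>real (X m j) - real (X 0 j)\<bar> \<le> 1"
          using X[of m] X[of 0] that by (smt (verit) le0 of_nat_Suc of_nat_le_iff)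
        then have "b * \<bar>real (X m j) - real (X 0 j)\<bar> / Suc N \<le> b * 1 / Suc N"
          using b by (intro divide_right_mono mult_left_mono) auto
        moreover have "sc (X m) j - sc (X 0) j = b * (real (X m j) - real (X 0 j)) / Suc N"
          by (simp add: sc_def diff_divide_distrib right_diff_distrib)
        ultimately show ?thesis
          using b by (simp add: abs_mult)
      qed
      then show ?thesis
        using X box by (intro exI[of _ "\<lambda>m. sc (X m)"]) blast
    qed
    then obtain X where X: "\<And>N m. m \<le> M \<Longrightarrow> box (X N m)" "\<And>N m. m \<le> M \<Longrightarrow> f (X N m) = m"
      "\<And>N m j. m \<le> M \<Longrightarrow> j < M \<Longrightarrow> \<bar>X N m j - X N 0 j\<bar> \<le> b / Suc N"
      by metis
    have lab: "label (X N m) m" if "m \<le> M" for N m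
      using f[OF X(1)[OF that]] X(2)[OF that] by metis
    \<comment> \<open>The cells shrink, so along one subsequence the points of all labels converge
      to the same \<open>u\<close>.\<close>
    obtain u \<phi> where u: "u \<in> D M" and \<phi>: "strict_mono (\<phi> :: nat \<Rightarrow> nat)"
      and lim0: "((\<lambda>N. pt (X N 0)) \<circ> \<phi>) \<longlonglongrightarrow> u"
      using D(1)[of M] ptD[OF X(1)[OF le0]] unfolding compact_def by meson
    have lim: "(\<lambda>N. pt (X (\<phi> N) m)) \<longlonglongrightarrow> u" if m: "m \<le> M" for m
    proof -
      have bound: "norm (pt (X N m) - pt (X N 0)) \<le> real M * (b / Suc N)" for N
      proof -
        have "pt (X N m) - pt (X N 0) = (\<Sum>j<M. (X N m j - X N 0 j) *\<^sub>R y j)"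
          by (simp add: pt_def sum_subtractf scaleR_left_diff_distrib)
        then have "norm (pt (X N m) - pt (X N 0)) \<le> (\<Sum>j<M. norm ((X N m j - X N 0 j) *\<^sub>R y j))"
          using norm_sum by metis
        also have "\<dots> \<le> (\<Sum>j<M. b / Suc N)"
          using X(3)[OF m] y1 by (intro sum_mono) auto
        finally show ?thesis
          by simp
      qed
      have "(\<lambda>N. real M * (b / Suc N)) \<longlonglongrightarrow> 0"
        using tendsto_mult_left[OF LIMSEQ_inverse_real_of_nat, of "real M * b"]
        by (simp only: divide_inverse mult.assoc mult_zero_right)
      then have "(\<lambda>N. pt (X N m) - pt (X N 0)) \<longlonglongrightarrow> 0"
        by (rule Lim_null_comparison[OF always_eventually[OF allI[OF bound]]])
      then have "((\<lambda>N. pt (X N m) - pt (X N 0)) \<circ> \<phi>) \<longlonglongrightarrow> 0"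
        using \<phi> by (rule LIMSEQ_subseq_LIMSEQ)
      from tendsto_add[OF this lim0] show ?thesis
        by (simp add: comp_def)
    qed
    define U where "U m = {x. \<exists>k\<in>L m. norm (x - c k) \<le> r k}" for m
    have "U m = (\<Union>k\<in>L m. cball (c k) (r k))" for m
      by (auto simp: U_def dist_norm norm_minus_commute)
    moreover have "finite (L m)" for m
      using G(1) LG finite_subset by blast
    ultimately have closedU: "closed (U m)" for m
      by (simp add: closed_UN)
    have inU: "z + u \<in> U m" if m: "m \<le> M" and ev: "\<forall>\<^sub>F N in sequentially. norm (pt (X (\<phi> N) m)) \<le> a" for m
    proof (rule Lim_in_closed_set[OF closedU])
      show "\<forall>\<^sub>F N in sequentially. z + pt (X (\<phi> N) m) \<in> U m"
        using ev by eventually_elim (use lab[OF m] in \<open>auto simp: U_def label_def\<close>)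
      show "(\<lambda>N. z + pt (X (\<phi> N) m)) \<longlonglongrightarrow> z + u"
        by (intro tendsto_intros lim m)
    qed simp
    \<comment> \<open>Label 0 is never artificial, so \<open>z + u\<close> lies in a ball of
      \<open>G 0\<close>. That ball contains \<open>z\<close>, so \<open>leave\<close> gives the
      strict bound \<open>norm u < a\<close>; hence the other labels are eventually genuine
      too.\<close>
    have "norm (pt (X N 0)) \<le> a" for N
      using lab[of 0 N] by (force simp: label_def)
    then have "z + u \<in> U 0"
      by (intro inU) auto
    then obtain k where "k \<in> G 0" "norm (z + u - c k) \<le> r k"
      by (auto simp: U_def L0)
    then have "norm u < a"
      using leave[of u k] G0 G(2)[of 0] u D(2)[of M] by force
    then have "z + u \<in> U m" if "m \<le> M" for m
      using order_tendstoD(2)[OF tendsto_norm[OF lim[OF that]], of a]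
      by (intro inU that) (auto elim: eventually_mono)
    then show ?thesis
      by (auto simp: U_def)
  qed
  show False
  proof (rule finite_levels_impossible[OF _ _ _ meet])
    show "finite (L m)" for m
      by (rule finite_subset[OF LG G(1)])
    show "L m \<subseteq> K" for m
      using LG G(2) by (rule order_trans)
    have less: "L m \<inter> L n = {}" if "m < n" for m n
    proof -
      have "L m \<subseteq> G (n - 1)"
        using LG by (rule order_trans) (use that in \<open>intro Gmono, simp\<close>)
      then show ?thesis
        using that by (auto simp: L_def)
    qed
    show "L m \<inter> L n = {}" if "m \<noteq> n" for m n
      using less[of m n] less[of n m] that by (cases "m < n") auto
  qed
qed

section \<open>From the local contradiction to countable coverings\<close>

lemma not_covering:
  assumes "countable K" and cover: "\<And>x. \<exists>k\<in>K. norm (x - c k) \<le> r k"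
  shows False
proof (cases "\<forall>x. \<exists>k\<in>K. norm (x - c k) < r k")
  case True
  let ?I = "{k \<in> K. norm (0 - c k) \<le> r k}"
  obtain b where b: "\<And>k. k \<in> ?I \<Longrightarrow> r k \<le> b"
    using finite_balls_at[of 0] by (metis (no_types, lifting) Max_ge finite_imageI imageI)
  show False
  \<comment> \<open>Here the whole space serves as the piece. A ball containing 0 has radius at most
    \<open>b\<close>, hence contains no point of norm above \<open>2 * b\<close>.\<close>
  proof (rule no_local_cover[OF _ fin_codim_UNIV, where z = 0 and a = "2 * \<bar>b\<bar> + 1"])
    show "\<exists>k\<in>K. norm (0 + y - c k) < r k" for y
      using True by blast
    fix y :: 'a and k
    assume h: "norm y \<ge> 2 * \<bar>b\<bar> + 1" "k \<in> K" "norm (0 - c k) \<le> r k"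
    then have "r k \<le> b"
      using b by blast
    moreover have "norm y \<le> norm (0 + y - c k) + norm (0 - c k)"
      using norm_triangle_ineq4[of "0 + y - c k" "0 - c k"] by simp
    ultimately show "norm (0 + y - c k) > r k"
      using h by linarith
  qed simp
next
  case False
  define Q where "Q = {x. \<forall>k\<in>K. r k \<le> norm (x - c k)}"
  have "Q \<noteq> {}"
    using False by (auto simp: Q_def not_less)
  have "Q = (\<Inter>k\<in>K. {x. r k \<le> norm (x - c k)})"
    by (auto simp: Q_def)
  moreover have "closed {x. r k \<le> norm (x - c k)}" for k
    by (intro closed_Collect_le continuous_intros)
  ultimately have "closed Q"
    by auto
  let ?X = "top_of_set Q"
  \<comment> \<open>\<open>Q\<close> is complete and is covered by its countably many closed
    intersections with balls, so by Baire one of them has interior relative to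
    \<open>Q\<close>.\<close>
  have "\<exists>k\<in>K. ?X interior_of (Q \<inter> cball (c k) (r k)) \<noteq> {}"
  proof (rule ccontr)
    assume none: "\<not> ?thesis"
    have "?X interior_of \<Union>((\<lambda>k. Q \<inter> cball (c k) (r k)) ` K) = {}"
    proof (rule Baire_category_alt)
      show "completely_metrizable_space ?X \<or> locally_compact_space ?X \<and> regular_space ?X"
        using \<open>closed Q\<close> completely_metrizable_space_closedin completely_metrizable_space_euclidean
        by (metis closed_closedin)
      show "countable ((\<lambda>k. Q \<inter> cball (c k) (r k)) ` K)"
        using \<open>countable K\<close> by blast
      fix T assume "T \<in> (\<lambda>k. Q \<inter> cball (c k) (r k)) ` K"
      then show "closedin ?X T \<and> ?X interior_of T = {}"
        using none by (auto intro: closedin_closed_Int)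
    qed
    moreover have "\<Union>((\<lambda>k. Q \<inter> cball (c k) (r k)) ` K) = topspace ?X"
      using cover by (fastforce simp: dist_norm norm_minus_commute)
    ultimately show False
      using \<open>Q \<noteq> {}\<close> by (metis interior_of_topspace topspace_euclidean_subtopology)
  qed
  then obtain k0 z where k0: "k0 \<in> K" and z: "z \<in> ?X interior_of (Q \<inter> cball (c k0) (r k0))"
    by blast
  then obtain T where T: "openin ?X T" "z \<in> T" "T \<subseteq> Q \<inter> cball (c k0) (r k0)"
    unfolding interior_of_def by blast
  then obtain \<epsilon> where \<epsilon>: "\<epsilon> > 0" and ball: "\<And>x. x \<in> Q \<Longrightarrow> norm (x - z) < \<epsilon> \<Longrightarrow> norm (x - c k0) \<le> r k0"
    unfolding openin_euclidean_subtopology_iff by (auto simp: dist_norm norm_minus_commute subset_iff)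
  have zQ: "r k \<le> norm (z - c k)" if "k \<in> K" for k
    using T that by (auto simp: Q_def)
  obtain \<epsilon>' R where \<epsilon>': "\<epsilon>' > 0" and R: "\<And>k. k \<in> K \<Longrightarrow> norm (z - c k) < r k + \<epsilon>' \<Longrightarrow> r k \<le> R"
    using radii_locally_bounded[of z] by blast
  define a where "a = \<epsilon> / 4"
  have a: "a > 0"
    using \<epsilon> by (simp add: a_def)
  obtain \<eta> where \<eta>: "\<eta> > 0"
    and exit: "\<And>(v::'a) y s. \<lbrakk>v \<bottom>\<^sub>B y; norm y \<ge> a; s \<le> R; norm v \<ge> s - \<eta>\<rbrakk> \<Longrightarrow> norm (v + y) > s + \<eta>"
    using rotund_exit[OF rotund a, of R] by blast
  \<comment> \<open>\<open>\<epsilon>/4\<close> keeps the piece within \<open>\<epsilon>\<close> of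
    \<open>z\<close>; \<open>\<eta>\<close> limits the depth of \<open>p\<close> in any ball, as
    \<open>z\<close> is interior to none; \<open>\<epsilon>'/2\<close> makes \<open>R\<close> bound
    the radii of the balls containing \<open>p\<close>.\<close>
  define s where "s = min (\<epsilon>/4) (min \<eta> (\<epsilon>'/2))"
  have s: "s > 0" "s + 2 * a < \<epsilon>" "s \<le> \<eta>" "s < \<epsilon>'"
    using \<epsilon> \<epsilon>' \<eta> by (auto simp: s_def a_def min_less_iff_disj)
  obtain Y1 where Y1: "fin_codim Y1" "\<And>y. y \<in> Y1 \<Longrightarrow> z - c k0 \<bottom>\<^sub>B y"
    using fin_codim_orth[OF smooth, of "{z - c k0}"] by (metis finite.emptyI finite.insertI insertI1)
  obtain u where u: "u \<in> Y1" "norm u = 1"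
    using fin_codim_unit_vector[OF Y1(1) infinite_dim] by blast
  \<comment> \<open>The shift \<open>u\<close> is tangential: \<open>z - c k0\<close> is orthogonal
    to it. As \<open>u\<close> is orthogonal to the directions in \<open>Y2\<close>, each
    \<open>p + y\<close> stays at distance at least \<open>s\<close> from \<open>z\<close>, so it
    leaves the ball of \<open>k0\<close>, which contains all points of \<open>Q\<close> near
    \<open>z\<close>.\<close>
  define p where "p = z + s *\<^sub>R u"
  have "finite (insert u ((\<lambda>k. p - c k) ` {k \<in> K. norm (p - c k) \<le> r k}))"
    using finite_balls_at by simp
  then obtain Y2 where Y2: "fin_codim Y2"
    and orth: "\<And>v y. v \<in> insert u ((\<lambda>k. p - c k) ` {k \<in> K. norm (p - c k) \<le> r k}) \<Longrightarrow> y \<in> Y2 \<Longrightarrow> v \<bottom>\<^sub>B y"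
    using fin_codim_orth[OF smooth] by blast
  show False
  proof (rule no_local_cover[OF a fin_codim_Int[OF Y1(1) Y2], of p])
    fix y assume y: "y \<in> Y1 \<inter> Y2" "norm y \<le> 2 * a"
    show "\<exists>k\<in>K. norm (p + y - c k) < r k"
    proof (rule ccontr)
      assume "\<not> ?thesis"
      then have "p + y \<in> Q"
        by (auto simp: Q_def not_less)
      define w where "w = s *\<^sub>R u + y"
      have pw: "p + y = z + w"
        by (simp add: p_def w_def)
      have "norm w \<le> s + 2 * a"
        using norm_triangle_ineq[of "s *\<^sub>R u" y] y u s by (simp add: w_def)
      then have inside: "norm (z + w - c k0) \<le> r k0"
        using ball[of "z + w"] \<open>p + y \<in> Q\<close> s pw by simp
      have "w \<in> Y1"
        unfolding w_def using subspace_fin_codim[OF Y1(1)] u y by (simp add: subspace_add subspace_scale)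
      then have orthw: "z - c k0 \<bottom>\<^sub>B w"
        by (rule Y1(2))
      have norm_w: "norm w \<ge> s"
      proof -
        have "norm u \<le> norm (u + (1 / s) *\<^sub>R y)"
          using orth[of u y] y unfolding birkhoff_orth_def by blast
        then have "s * norm u \<le> s * norm (u + (1 / s) *\<^sub>R y)"
          using s by (intro mult_left_mono) auto
        also have "\<dots> = norm (s *\<^sub>R (u + (1 / s) *\<^sub>R y))"
          using s by simp
        also have "s *\<^sub>R (u + (1 / s) *\<^sub>R y) = w"
          using s by (simp add: w_def scaleR_right_distrib)
        finally show ?thesis
          using u by simp
      qed
      obtain \<eta>' where \<eta>': "\<eta>' > 0"
        and out: "\<And>(v::'a) y t. \<lbrakk>v \<bottom>\<^sub>B y; norm y \<ge> s; t \<le> r k0; norm v \<ge> t - \<eta>'\<rbrakk> \<Longrightarrow> norm (v + y) > t + \<eta>'"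
        using rotund_exit[OF rotund s(1), of "r k0"] by blast
      have "norm (z - c k0) \<ge> r k0 - \<eta>'"
        using zQ[OF k0] \<eta>' by linarith
      then have "norm (z - c k0 + w) > r k0 + \<eta>'"
        by (rule out[OF orthw norm_w order_refl])
      then show False
        using inside \<eta>' by (simp add: algebra_simps)
    qed
  next
    fix y k
    assume h: "y \<in> Y1 \<inter> Y2" "a \<le> norm y" "k \<in> K" "norm (p - c k) \<le> r k"
    have zp: "norm (z - p) = s"
      using u s by (simp add: p_def)
    have "norm (z - c k) \<le> norm (p - c k) + s"
      using norm_triangle_ineq[of "z - p" "p - c k"] zp by simp
    then have "r k \<le> R" "norm (p - c k) \<ge> r k - \<eta>"
      using R[of k] zQ[of k] h s by auto
    moreover have "p - c k \<bottom>\<^sub>B y"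
      using h by (intro orth) auto
    ultimately have "norm (p - c k + y) > r k + \<eta>"
      using h by (intro exit) auto
    then show "norm (p + y - c k) > r k"
      using \<eta> by (simp add: algebra_simps)
  qed
qed

end

theorem theorem1p5:
  fixes \<B> :: "'a::banach set set"
  assumes infinite_dimensional: "\<not> (\<exists>S::'a set. finite S \<and> span S = UNIV)"
    and separable: "\<exists>D::'a set. countable D \<and> closure D = UNIV"
    and rotund: "uniformly_rotund TYPE('a)"
    and smooth: "uniformly_smooth TYPE('a)"
    and balls: "\<And>B. B \<in> \<B> \<Longrightarrow> \<exists>c r. r > 0 \<and> B = cball c r"
    and covering: "\<Union>\<B> = UNIV"
  shows "\<not> point_finite \<B>"
proof
  assume pf: "point_finite \<B>"
  have "\<forall>B\<in>\<B>. \<exists>c r. r > 0 \<and> B = cball c r"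
    using balls by blast
  then obtain c r where cr: "\<And>B. B \<in> \<B> \<Longrightarrow> r B > 0" "\<And>B. B \<in> \<B> \<Longrightarrow> B = cball (c B) (r B)"
    by metis
  have mem: "x \<in> B \<longleftrightarrow> norm (x - c B) \<le> r B" if "B \<in> \<B>" for x B
    using cr(2)[OF that] by (metis dist_commute dist_norm mem_cball)
  have fin: "finite {B \<in> \<B>. x \<in> B}" for x
    using pf by (auto simp: point_finite_def)
  interpret point_finite_balls \<B> c r
  proof
    show "finite {B \<in> \<B>. norm (x - c B) \<le> r B}" for x
      using fin[of x] mem by (metis (mono_tags, lifting) Collect_cong)
  qed (use rotund smooth infinite_dimensional cr in auto)
  obtain D :: "'a set" where D: "countable D" "closure D = UNIV"
    using separable by blast
  \<comment> \<open>Each ball contains a point of \<open>D\<close>, and each point of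
    \<open>D\<close> lies in finitely many balls. The resulting countability feeds the Baire
    argument.\<close>
  have "\<B> \<subseteq> (\<Union>x\<in>D. {B \<in> \<B>. x \<in> B})"
  proof
    fix B assume B: "B \<in> \<B>"
    have "c B \<in> closure D"
      using D by simp
    then obtain x where "x \<in> D" "dist x (c B) < r B"
      using cr(1)[OF B] by (auto simp: closure_approachable)
    then show "B \<in> (\<Union>x\<in>D. {B \<in> \<B>. x \<in> B})"
      using B mem[OF B, of x] by (auto simp: dist_norm)
  qed
  moreover have "countable (\<Union>x\<in>D. {B \<in> \<B>. x \<in> B})"
    by (intro countable_UN D(1) countable_finite fin)
  ultimately have "countable \<B>"
    by (rule countable_subset)
  moreover have "\<exists>B\<in>\<B>. norm (x - c B) \<le> r B" for x
  proof -
    obtain B where "B \<in> \<B>" "x \<in> B"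
      using covering by blast
    then show ?thesis
      using mem by blast
  qed
  ultimately show False
    by (rule not_covering)
qed

end
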